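(* Let $\psi:\mathbb{N}\to[0,\infty)$ be an arbitrary function and let $\gamma\in\mathbb{R}$ be an irrational number which is not a Liouville number. Define \[ A_{2,1}^{\psi,\gamma}:=\Big\{\boldsymbol{\alpha}=(\alpha_1,\alpha_2)\in\mathbb{T}^{2}:\ |q_1\alpha_1+q_2\alpha_2+p-\gamma|\le\psi(|\mathbf{q}|)\ \text{for infinitely many }(\mathbf{q},p)\in(\mathbb{Z}^2\setminus\{\mathbf{0}\})\times\mathbb{Z}\Big\}, \] where $\mathbf{q}=(q_1,q_2)$ and $|\mathbf{q}|=\max\{|q_1|,|q_2|\}$. Then \[ \lambda_2\big(A_{2,1}^{\psi,\gamma}\big)=\begin{cases}0&\text{if }\sum_{q\in\mathbb{N}}q\psi(q)<\infty,\\ 1&\text{if }\sum_{q\in\mathbb{N}}q\psi(q)=\infty,\end{cases} \] where $\lambda_2$ is the Lebesgue (Haar) measure on $\mathbb{T}^2$.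
   Context: $\mathbb{T}^2=\mathbb{R}^2/\mathbb{Z}^2$, identified with $[0,1)^2$. For $x\in\mathbb{R}$, $\|x\|$ denotes the distance from $x$ to the nearest integer. A real number $\gamma$ is called a Liouville number if for every $\eta\in\mathbb{N}$ there exists an integer $q\ge 2$ with $\|q\gamma\|\le q^{-\eta}$. *)

theory Defs
  imports "HOL-Analysis.Analysis"
begin

definition dist_int :: "real \<Rightarrow> real" where
  "dist_int x = \<bar>x - of_int (round x)\<bar>"

definition liouville_number :: "real \<Rightarrow> bool" where
  "liouville_number \<gamma> \<longleftrightarrow>
     (\<forall>\<eta>::nat. \<exists>q::nat. q \<ge> 2 \<and> dist_int (real q * \<gamma>) \<le> 1 / real q ^ \<eta>)"

(* The torus is represented by its fundamental domain [0,1)^2. *)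
definition torus2 :: "(real \<times> real) set" where
  "torus2 = {0..<1} \<times> {0..<1}"

definition inhom_approx_set :: "(nat \<Rightarrow> real) \<Rightarrow> real \<Rightarrow> (real \<times> real) set" where
  "inhom_approx_set \<psi> \<gamma> =
     {(\<alpha>1, \<alpha>2) \<in> torus2.
        infinite {((q1 :: int, q2 :: int), p :: int). (q1, q2) \<noteq> (0, 0) \<and>
          \<bar>of_int q1 * \<alpha>1 + of_int q2 * \<alpha>2 + of_int p - \<gamma>\<bar> \<le> \<psi> (nat (max \<bar>q1\<bar> \<bar>q2\<bar>))}}"

end

theory Submission
  imports Defs "HOL-Probability.Probability" "HOL-Real_Asymp.Real_Asymp"
begin

text \<open>
  The convergence case is Borel--Cantelli. For divergence one replaces \<open>\<psi>\<close> by
  \<open>\<phi> n = min (\<psi> n) (1 / (2 n))\<close>, which keeps \<open>\<Sum> n \<phi> n\<close> divergent, keeps only the vectors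
  \<open>(k, n)\<close> with \<open>1 \<le> k \<le> n\<close>, and applies Chebyshev's inequality to the number of solutions with
  \<open>n \<le> N\<close>, whose mean is \<open>S N = 2 \<Sum>n\<le>N. n \<phi> n\<close>. The events of linearly independent vectors are
  independent. For parallel vectors with \<open>n < m\<close>, \<open>d = gcd n m\<close>, \<open>n = a d\<close>, \<open>m = b d\<close>, the
  overlap exceeds a harmless term only if \<open>\<parallel>(b - a) \<gamma>\<parallel> \<le> b / d\<close>; as \<open>\<gamma>\<close> is not Liouville, this forces
  \<open>b\<close> to be at least a fixed power of \<open>m\<close>. By the divisor bound \<open>\<tau>(m) = O(m ^ \<epsilon>)\<close>, the excess summed
  over \<open>n < m\<close> is then \<open>O(m \<phi> m)\<close>. So the variance is \<open>O(S N)\<close>, and the number of solutions is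
  almost surely unbounded.
\<close>

section \<open>A second moment criterion\<close>

text \<open>Chebyshev: the number of events of the family \<open>F n\<close> that occur at
  \<open>x\<close> has mean \<open>S n\<close> and variance at most \<open>C * S n\<close>, so it
  stays below a fixed bound with probability O(1 / S n). Almost surely the counts are therefore
  unbounded, which forces infinitely many events.\<close>

lemma (in prob_space) AE_infinite_if_variance_le:
  fixes A :: "'i \<Rightarrow> 'a set" and F :: "nat \<Rightarrow> 'i set"
  defines "S \<equiv> \<lambda>n. \<Sum>i\<in>F n. prob (A i)"
  assumes meas [measurable]: "\<And>i. A i \<in> events" and fin: "\<And>n. finite (F n)"
    and S: "filterlim S at_top sequentially"
    and pairs: "\<And>n. (\<Sum>i\<in>F n. \<Sum>j\<in>F n. prob (A i \<inter> A j)) \<le> (S n)\<^sup>2 + C * S n"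
  shows "AE x in M. infinite {i. x \<in> A i}"
proof -
  define Z where "Z n x = (\<Sum>i\<in>F n. indicator (A i) x :: real)" for n x
  have [measurable]: "Z n \<in> borel_measurable M" for n unfolding Z_def by measurable
  have integrable_ind: "integrable M (\<lambda>x. indicator (A i \<inter> A j) x :: real)" for i j
    by (rule integrable_real_indicator) (auto simp: emeasure_eq_measure)
  have Z: "integrable M (Z n)" "expectation (Z n) = S n" for n
    using integrable_ind[of i i for i] by (simp_all add: Z_def[abs_def] S_def Bochner_Integration.integral_sum)
  have Z2_eq: "(Z n x)\<^sup>2 = (\<Sum>i\<in>F n. \<Sum>j\<in>F n. indicator (A i \<inter> A j) x)" for n x
    by (simp add: Z_def power2_eq_square sum_product indicator_inter_arith)
  have Z2: "integrable M (\<lambda>x. (Z n x)\<^sup>2)"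
    "expectation (\<lambda>x. (Z n x)\<^sup>2) = (\<Sum>i\<in>F n. \<Sum>j\<in>F n. prob (A i \<inter> A j))" for n
    unfolding Z2_eq using integrable_ind by (simp_all add: Bochner_Integration.integral_sum)
  have var: "variance (Z n) \<le> C * S n" for n
    using pairs[of n] variance_eq[OF Z(1)[of n] Z2(1)[of n]] unfolding Z(2) Z2(2) by linarith
  have null: "AE x in M. \<not> (\<forall>n. Z n x \<le> real K)" for K :: nat
  proof -
    define B where "B = {x \<in> space M. \<forall>n. Z n x \<le> real K}"
    have [measurable]: "B \<in> events" unfolding B_def by measurable
    \<comment> \<open>Once \<open>S n > 2 * K\<close>, a point of \<open>B\<close> deviates from the
      mean by at least \<open>S n / 2\<close>; this is the source of the 4.\<close>
    have "eventually (\<lambda>n. prob B \<le> 4 * C / S n) sequentially"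
      using filterlim_at_top_dense[THEN iffD1, OF S, rule_format, of "2 * real K"]
    proof eventually_elim
      case (elim n)
      have pos: "0 < S n - real K" "S n > 0" "S n / 2 \<le> S n - real K" using elim by linarith+
      have "prob B \<le> prob {x \<in> space M. S n - real K \<le> \<bar>Z n x - expectation (Z n)\<bar>}"
      proof (rule finite_measure_mono)
        have "S n - real K \<le> \<bar>Z n x - S n\<bar>" if "x \<in> B" for x
          using that by (auto simp: B_def abs_if dest: spec[of _ n])
        then show "B \<subseteq> {x \<in> space M. S n - real K \<le> \<bar>Z n x - expectation (Z n)\<bar>}"
          unfolding Z(2) by (auto simp: B_def)
      qed measurable
      also have "\<dots> \<le> variance (Z n) / (S n - real K)\<^sup>2"
        using Z2 pos by (intro Chebyshev_inequality) auto
      also have "\<dots> \<le> variance (Z n) / (S n / 2)\<^sup>2"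
        using pos by (intro divide_left_mono power_mono mult_pos_pos) auto
      also have "\<dots> \<le> C * S n / (S n / 2)\<^sup>2"
        by (intro divide_right_mono var) auto
      also have "\<dots> = 4 * C / S n" using pos by (simp add: field_simps power2_eq_square)
      finally show ?case .
    qed
    moreover have "((\<lambda>n. 4 * C / S n) \<longlongrightarrow> 0) sequentially"
      using S by (intro tendsto_divide_0[OF tendsto_const] filterlim_at_top_imp_at_infinity)
    ultimately have "prob B \<le> 0"
      by (intro tendsto_lowerbound[where F = sequentially]) auto
    then have "B \<in> null_sets M"
      by (intro null_setsI) (auto simp: emeasure_eq_measure measure_nonneg antisym)
    then show ?thesis by (rule AE_I'[where N = B]) (auto simp: B_def)
  qed
  have "AE x in M. \<forall>K::nat. \<not> (\<forall>n. Z n x \<le> real K)" using null by (subst AE_all_countable) auto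
  then show ?thesis
  proof eventually_elim
    case (elim x)
    show ?case
    proof
      assume f: "finite {i. x \<in> A i}"
      have "Z n x \<le> real (card {i. x \<in> A i})" for n
      proof -
        have "Z n x = real (card {i \<in> F n. x \<in> A i})"
          by (simp add: Z_def indicator_def fin sum.If_cases Int_def)
        also have "\<dots> \<le> real (card {i. x \<in> A i})"
          by (intro of_nat_mono card_mono f) auto
        finally show ?thesis .
      qed
      then show False using elim by blast
    qed
  qed
qed

section \<open>The divisor bound and sums of greatest common divisors\<close>

lemma card_divisors_mult_le:
  fixes m n :: nat
  assumes "0 < m" "0 < n"
  shows "card {d. d dvd m * n} \<le> card {d. d dvd m} * card {d. d dvd n}"
proof -
  have "{d. d dvd m * n} \<subseteq> (\<lambda>(x, y). x * y) ` ({d. d dvd m} \<times> {d. d dvd n})"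
  proof
    fix d assume "d \<in> {d. d dvd m * n}"
    then obtain x y where "d = x * y" "x dvd m" "y dvd n" by (blast dest: division_decomp)
    then show "d \<in> (\<lambda>(x, y). x * y) ` ({d. d dvd m} \<times> {d. d dvd n})" by auto
  qed
  then have "card {d. d dvd m * n} \<le> card ({d. d dvd m} \<times> {d. d dvd n})"
    using assms by (intro surj_card_le) auto
  then show ?thesis by (simp add: card_cartesian_product)
qed

lemma card_divisors_prime_power_le:
  fixes p :: nat
  assumes "prime p"
  shows "card {d. d dvd p ^ a} \<le> a + 1"
proof -
  have "{d. d dvd p ^ a} = (\<lambda>i. p ^ i) ` {..a}"
    using assms by (auto simp: divides_primepow_nat)
  then show ?thesis using card_image_le[of "{..a}" "\<lambda>i. p ^ i"] by simp
qed

text \<open>Only the finitely many primes below \<open>2 ^ k\<close> contribute a constant, since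
  \<open>(a + 1) ^ k \<le> p ^ a\<close> for \<open>p \<ge> 2 ^ k\<close>.\<close>

lemma divisor_bound:
  fixes k :: nat
  shows "\<exists>C\<ge>1::real. \<forall>m>0. real (card {d. d dvd m}) ^ k \<le> C * real m"
proof -
  \<comment> \<open>An exponential beats a power, so one constant bounds the loss at a single prime
    uniformly in its exponent \<open>a\<close>.\<close>
  have "(\<lambda>a::nat. (real a + 1) ^ k / 2 ^ a) \<longlonglongrightarrow> 0" by real_asymp
  then have "Bseq (\<lambda>a::nat. (real a + 1) ^ k / 2 ^ a)" by (rule convergent_imp_Bseq[OF convergentI])
  then obtain C0 where C0: "\<And>a::nat. \<bar>(real a + 1) ^ k / 2 ^ a\<bar> \<le> C0" by (auto simp: Bseq_def)
  define C where "C = max 1 C0"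
  have C1: "1 \<le> C" by (simp add: C_def)
  have C: "(real a + 1) ^ k \<le> C * 2 ^ a" for a :: nat
  proof -
    have "(real a + 1) ^ k / 2 ^ a \<le> C" using C0[of a] by (simp add: C_def)
    then show ?thesis by (simp add: field_simps)
  qed
  \<comment> \<open>Detaching a prime power multiplies the constants: \<open>c\<close> is the price
    of \<open>p ^ a\<close>, \<open>e\<close> that of the cofactor \<open>x\<close>.\<close>
  have step: "real (card {d. d dvd p ^ a * x}) ^ k \<le> c * real (p ^ a) * (e * real x)"
    if "prime p" "0 < x" "real (card {d. d dvd x}) ^ k \<le> e * real x" "(real a + 1) ^ k \<le> c * real (p ^ a)"
    for p a x :: nat and c e :: real
  proof -
    have "0 < p ^ a" using prime_gt_0_nat[OF that(1)] by simp
    then have "card {d. d dvd p ^ a * x} \<le> card {d. d dvd p ^ a} * card {d. d dvd x}"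
      using that(2) by (rule card_divisors_mult_le)
    also have "\<dots> \<le> (a + 1) * card {d. d dvd x}"
      by (rule mult_right_mono[OF card_divisors_prime_power_le[OF that(1)]]) simp
    finally have "real (card {d. d dvd p ^ a * x}) \<le> real ((a + 1) * card {d. d dvd x})"
      by (rule of_nat_mono)
    also have "\<dots> = (real a + 1) * real (card {d. d dvd x})"
      by (simp only: of_nat_mult of_nat_add of_nat_1)
    finally have "real (card {d. d dvd p ^ a * x}) ^ k \<le> ((real a + 1) * real (card {d. d dvd x})) ^ k"
      by (rule power_mono) simp
    also have "\<dots> = (real a + 1) ^ k * real (card {d. d dvd x}) ^ k" by (rule power_mult_distrib)
    also have "\<dots> \<le> (c * real (p ^ a)) * (e * real x)"
      by (rule mult_mono[OF that(4,3) order_trans[OF _ that(4)]]) simp_all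
    finally show ?thesis .
  qed
  \<comment> \<open>Induction on \<open>j\<close> strips the primes below \<open>j\<close> one by
    one, at the price of a factor \<open>C\<close> each; at \<open>j = 2 ^ k\<close> every
    \<open>m > 0\<close> is covered.\<close>
  have bound: "real (card {d. d dvd m}) ^ k \<le> C ^ j * real m"
    if "0 < m" "\<And>p. prime p \<Longrightarrow> p dvd m \<Longrightarrow> 2 ^ k \<le> p \<or> p < j" for j m :: nat
    using that
  proof (induction j arbitrary: m)
    case 0
    \<comment> \<open>Here all primes of \<open>m\<close> are at least \<open>2 ^ k\<close>, so
      stripping one full prime power after another costs no constant.\<close>
    then show ?case
    proof (induction m rule: less_induct)
      case (less m)
      show ?case
      proof (cases "m = 1")
        case False
        then obtain p where p: "prime p" "p dvd m" using prime_factor_nat by blast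
        obtain a x where x: "m = p ^ a * x" "\<not> p dvd x"
          using multiplicity_decompose'[of m p] p(1) less.prems(1) by (metis not_prime_unit not_gr_zero)
        have "a \<noteq> 0"
        proof
          assume "a = 0"
          then show False using x p(2) by simp
        qed
        have "0 < x" using x less.prems by (cases "x = 0") auto
        have "1 < p ^ a" using p \<open>a \<noteq> 0\<close> by (intro one_less_power prime_gt_1_nat) auto
        then have "1 * x < p ^ a * x" using \<open>0 < x\<close> by (intro mult_strict_right_mono)
        then have "x < m" using x(1) by simp
        have "2 ^ k \<le> q \<or> q < 0" if "prime q" "q dvd x" for q
          by (rule less.prems(2)) (use that x(1) in auto)
        then have IH: "real (card {d. d dvd x}) ^ k \<le> 1 * real x"
          using less.IH[OF \<open>x < m\<close> \<open>0 < x\<close>] by simp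
        have "(real a + 1) \<le> 2 ^ a"
          by (induction a) auto
        then have "(real a + 1) ^ k \<le> (2 ^ a) ^ k" by (intro power_mono) auto
        also have "\<dots> = real ((2 ^ k) ^ a)" by (simp only: of_nat_power of_nat_numeral flip: power_mult) (simp only: mult.commute)
        also have "\<dots> \<le> real (p ^ a)"
          using less.prems(2)[OF p] by (intro of_nat_mono power_mono) auto
        finally have "real (card {d. d dvd p ^ a * x}) ^ k \<le> 1 * real (p ^ a) * (1 * real x)"
          using step[OF p(1) \<open>0 < x\<close> IH, of a 1] by simp
        then show ?thesis using x(1) by simp
      qed simp
    qed
  next
    case (Suc j)
    show ?case
    proof (cases "prime j \<and> j dvd m")
      case True
      then have p: "prime j" by simp
      obtain a x where x: "m = j ^ a * x" "\<not> j dvd x"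
        using multiplicity_decompose'[of m j] p Suc.prems(1) by (metis not_prime_unit not_gr_zero)
      have "0 < x" using x Suc.prems by (cases "x = 0") auto
      \<comment> \<open>After the full power of \<open>j\<close> is removed, every prime of
        \<open>x\<close> is below \<open>j\<close> or at least \<open>2 ^ k\<close>.\<close>
      have IH: "real (card {d. d dvd x}) ^ k \<le> C ^ j * real x"
      proof (rule Suc.IH[OF \<open>0 < x\<close>])
        fix p assume "prime p" "p dvd x"
        then have "2 ^ k \<le> p \<or> p < Suc j" using x(1) by (intro Suc.prems(2)) auto
        moreover have "p \<noteq> j" using x(2) \<open>p dvd x\<close> by auto
        ultimately show "2 ^ k \<le> p \<or> p < j" by auto
      qed
      have "(real a + 1) ^ k \<le> C * 2 ^ a" by (rule C)
      also have "\<dots> \<le> C * real (j ^ a)"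
        using C1 prime_ge_2_nat[OF p] by (intro mult_left_mono) (auto intro!: power_mono)
      finally have "real (card {d. d dvd j ^ a * x}) ^ k \<le> C * real (j ^ a) * (C ^ j * real x)"
        by (rule step[OF p \<open>0 < x\<close> IH])
      also have "\<dots> = C ^ Suc j * real (j ^ a * x)" by simp
      finally show ?thesis using x(1) by simp
    next
      case False
      then have "real (card {d. d dvd m}) ^ k \<le> C ^ j * real m"
        using Suc.prems by (intro Suc.IH) (auto simp: less_Suc_eq)
      also have "\<dots> \<le> C ^ Suc j * real m"
        using C1 by (intro mult_right_mono power_increasing) auto
      finally show ?thesis .
    qed
  qed
  have "\<forall>m>0. real (card {d. d dvd m}) ^ k \<le> C ^ (2 ^ k) * real m"
  proof (intro allI impI)
    fix m :: nat assume "0 < m"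
    then show "real (card {d. d dvd m}) ^ k \<le> C ^ (2 ^ k) * real m"
      by (rule bound) auto
  qed
  then show ?thesis using one_le_power[OF C1] by blast
qed

text \<open>The sum is at most the number of divisors of \<open>m\<close> over the least admissible
  divisor \<open>\<beta>\<close>. Its \<open>h\<close>-th power is at most
  \<open>C * m / \<beta> ^ h\<close> by the divisor bound, and
  \<open>m \<le> K * \<beta> ^ h\<close> cancels the denominator.\<close>

lemma sum_reciprocal_large_divisors_le:
  fixes K :: real and h :: nat
  assumes "0 < h" "0 \<le> K"
  shows "\<exists>B\<ge>0. \<forall>m>0. (\<Sum>b | b dvd m \<and> real m \<le> K * real b ^ h. 1 / real b) \<le> B"
proof -
  obtain C :: real where C: "1 \<le> C" "\<And>m. 0 < m \<Longrightarrow> real (card {d. d dvd m}) ^ h \<le> C * real m"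
    using divisor_bound[of h] by blast
  show ?thesis
  proof (intro exI[of _ "max 1 (C * K)"] conjI allI impI)
    show "0 \<le> max 1 (C * K)" by simp
    fix m :: nat assume "0 < m"
    define Q where "Q = {b. b dvd m \<and> real m \<le> K * real b ^ h}"
    define T where "T = (\<Sum>b\<in>Q. 1 / real b)"
    have finQ: "finite Q" using \<open>0 < m\<close> by (auto simp: Q_def)
    have "T \<le> max 1 (C * K)"
    proof (cases "Q = {}")
      case False
      define \<beta> where "\<beta> = Min Q"
      have \<beta>: "\<beta> \<in> Q" using False finQ by (simp add: \<beta>_def)
      then have "0 < \<beta>" using \<open>0 < m\<close> by (auto simp: Q_def intro: Nat.gr0I)
      have "T \<le> (\<Sum>b\<in>Q. 1 / real \<beta>)"
        unfolding T_def
      proof (rule sum_mono)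
        fix b assume "b \<in> Q"
        then have "\<beta> \<le> b" using finQ by (simp add: \<beta>_def)
        then show "1 / real b \<le> 1 / real \<beta>" using \<open>0 < \<beta>\<close> by (simp add: frac_le)
      qed
      also have "\<dots> \<le> real (card {d. d dvd m}) / real \<beta>"
        using \<open>0 < m\<close> by (auto intro!: divide_right_mono card_mono simp: Q_def)
      finally have T: "T \<le> real (card {d. d dvd m}) / real \<beta>" .
      have "0 \<le> T" by (simp add: T_def sum_nonneg)
      then have "T ^ h \<le> (real (card {d. d dvd m}) / real \<beta>) ^ h"
        using T by (rule power_mono[rotated])
      also have "\<dots> \<le> C * real m / real \<beta> ^ h"
        using C(2)[OF \<open>0 < m\<close>] by (simp add: power_divide divide_right_mono)
      also have "\<dots> \<le> C * (K * real \<beta> ^ h) / real \<beta> ^ h"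
        using \<beta> C(1) by (intro divide_right_mono mult_left_mono) (auto simp: Q_def)
      also have "\<dots> = C * K" using \<open>0 < \<beta>\<close> by simp
      finally have Th: "T ^ h \<le> C * K" .
      \<comment> \<open>The bound on \<open>T ^ h\<close> passes to \<open>T\<close> when
        \<open>T > 1\<close>; hence the maximum with 1.\<close>
      show ?thesis
      proof (cases "T \<le> 1")
        case False
        then have "T ^ 1 \<le> T ^ h" using \<open>0 < h\<close> by (intro power_increasing) auto
        then show ?thesis using Th by simp
      qed simp
    qed (simp add: T_def)
    then show "(\<Sum>b | b dvd m \<and> real m \<le> K * real b ^ h. 1 / real b) \<le> max 1 (C * K)"
      by (simp add: T_def Q_def)
  qed
qed

text \<open>Such \<open>n\<close> give fractions n / m with reduced denominator \<open>b\<close>;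
  the reduced numerator \<open>n div gcd n m\<close> lies below \<open>b\<close> and determines
  \<open>n\<close>.\<close>

lemma card_reduced_denominator_le:
  fixes m b :: nat
  assumes "0 < m"
  shows "card {n \<in> {1..<m}. m div gcd n m = b} \<le> b"
proof -
  have eq: "n = n div gcd n m * (m div b)" "n div gcd n m < b"
    if "n \<in> {1..<m}" "m div gcd n m = b" for n
  proof -
    define g where "g = gcd n m"
    have mb: "b * g = m" and ng: "n div g * g = n" using that by (auto simp: g_def)
    then have "0 < b" "0 < g" using assms by (auto intro: Nat.gr0I)
    then have "m div b = g" using mb by auto
    then show "n = n div gcd n m * (m div b)" using ng unfolding g_def by metis
    have "n < b * g" using that mb by auto
    then show "n div gcd n m < b" unfolding g_def by (rule less_mult_imp_div_less)
  qed
  have "inj_on (\<lambda>n. n div gcd n m) {n \<in> {1..<m}. m div gcd n m = b}"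
  proof (rule inj_onI)
    fix n n'
    assume n: "n \<in> {n \<in> {1..<m}. m div gcd n m = b}" "n' \<in> {n \<in> {1..<m}. m div gcd n m = b}"
      and same: "n div gcd n m = n' div gcd n' m"
    have "n = n div gcd n m * (m div b)" using n by (intro eq(1)) auto
    also have "\<dots> = n' div gcd n' m * (m div b)" by (simp only: same)
    also have "\<dots> = n'" using n by (intro eq(1)[symmetric]) auto
    finally show "n = n'" .
  qed
  moreover have "(\<lambda>n. n div gcd n m) ` {n \<in> {1..<m}. m div gcd n m = b} \<subseteq> {..<b}"
    using eq(2) by auto
  ultimately show ?thesis using card_inj_on_le[of _ _ "{..<b}"] by fastforce
qed

text \<open>With \<open>b = m div gcd n m\<close> the summand is 1 / b^2, and each \<open>b\<close>
  arises from at most \<open>b\<close> values of \<open>n\<close>, so the sum of 1 / b over the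
  large divisors of \<open>m\<close> dominates.\<close>

lemma sum_gcd_squares_le:
  fixes K :: real and h :: nat
  assumes "0 < h" "0 \<le> K"
  shows "\<exists>B\<ge>0. \<forall>m>0. (\<Sum>n | n \<in> {1..<m} \<and> real m \<le> K * real (m div gcd n m) ^ h.
        (real (gcd n m) / real m)\<^sup>2) \<le> B"
proof -
  obtain B :: real where B: "0 \<le> B"
    "\<And>m. 0 < m \<Longrightarrow> (\<Sum>b | b dvd m \<and> real m \<le> K * real b ^ h. 1 / real b) \<le> B"
    using sum_reciprocal_large_divisors_le[OF assms] by blast
  show ?thesis
  proof (intro exI[of _ B] conjI allI impI B(1))
    fix m :: nat assume m: "0 < m"
    define N where "N = {n. n \<in> {1..<m} \<and> real m \<le> K * real (m div gcd n m) ^ h}"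
    define Q where "Q = {b. b dvd m \<and> real m \<le> K * real b ^ h}"
    have "finite N" "finite Q" using m by (auto simp: N_def Q_def)
    have "m div gcd n m dvd m" for n
        by (rule dvdI[of _ _ "gcd n m"]) simp
    then have img: "(\<lambda>n. m div gcd n m) ` N \<subseteq> Q" by (auto simp: N_def Q_def)
    have "(\<Sum>n\<in>N. (real (gcd n m) / real m)\<^sup>2) = (\<Sum>n\<in>N. 1 / (real (m div gcd n m))\<^sup>2)"
      by (simp add: real_of_nat_div power_divide)
    also have "\<dots> = (\<Sum>b\<in>Q. \<Sum>n\<in>{n\<in>N. m div gcd n m = b}. 1 / (real (m div gcd n m))\<^sup>2)"
      by (rule sum.group[symmetric, OF \<open>finite N\<close> \<open>finite Q\<close> img])
    also have "\<dots> = (\<Sum>b\<in>Q. real (card {n\<in>N. m div gcd n m = b}) * (1 / (real b)\<^sup>2))"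
      by simp
    also have "\<dots> \<le> (\<Sum>b\<in>Q. real b * (1 / (real b)\<^sup>2))"
    proof (intro sum_mono mult_right_mono of_nat_mono)
      fix b
      have "card {n\<in>N. m div gcd n m = b} \<le> card {n \<in> {1..<m}. m div gcd n m = b}"
        by (intro card_mono) (auto simp: N_def)
      then show "card {n\<in>N. m div gcd n m = b} \<le> b"
        using card_reduced_denominator_le[OF m, of b] by linarith
    qed auto
    also have "\<dots> = (\<Sum>b\<in>Q. 1 / real b)" by (intro sum.cong) (auto simp: power2_eq_square)
    also have "\<dots> \<le> B" using B(2)[OF m] by (simp add: Q_def)
    finally show "(\<Sum>n | n \<in> {1..<m} \<and> real m \<le> K * real (m div gcd n m) ^ h.
        (real (gcd n m) / real m)\<^sup>2) \<le> B" by (simp add: N_def)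
  qed
qed

section \<open>Linear forms on the unit square\<close>

text \<open>Haar measure on the circle R/Z, placed on the whole real line so that 1-periodic
  functions are integrated without reducing arguments modulo 1.\<close>

definition unit_unif :: "real measure" where
  "unit_unif = density lborel (indicator {0..<1})"

lemma sets_unit_unif [measurable_cong, simp]: "sets unit_unif = sets borel"
  by (simp add: unit_unif_def)

lemma space_unit_unif [simp]: "space unit_unif = UNIV"
  by (simp add: unit_unif_def)

lemma nn_integral_unit_unif:
  assumes [measurable]: "h \<in> borel_measurable borel"
  shows "(\<integral>\<^sup>+x. h x \<partial>unit_unif) = (\<integral>\<^sup>+x. indicator {0..<1} x * h x \<partial>lborel)"
  unfolding unit_unif_def by (subst nn_integral_density) auto

interpretation unit_unif: prob_space unit_unif
  by standard (simp add: unit_unif_def emeasure_density)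

lemma emeasure_unit_unif_UNIV [simp]: "emeasure unit_unif UNIV = 1"
  using unit_unif.emeasure_space_1 by simp

interpretation unit_unif2: pair_prob_space unit_unif unit_unif ..

lemma periodic_int:
  fixes h :: "real \<Rightarrow> 'a"
  assumes "\<And>x. h (x + 1) = h x"
  shows "h (x + of_int k) = h x"
proof (induction k rule: int_induct[where k = 0])
  case (step1 i)
  then show ?case using assms[of "x + of_int i"] by (simp add: algebra_simps)
next
  case (step2 i)
  then show ?case using assms[of "x + of_int i - 1"] by (simp add: algebra_simps)
qed simp

text \<open>Only the fractional part \<open>d\<close> of the shift matters; it moves [0, 1) to [d, 1
  + d), and periodicity brings the part beyond 1 back to [0, d).\<close>

lemma nn_integral_unit_shift:
  assumes [measurable]: "h \<in> borel_measurable borel" and per: "\<And>x. h (x + 1) = h x"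
  shows "(\<integral>\<^sup>+x. h (x + c) \<partial>unit_unif) = (\<integral>\<^sup>+x. h x \<partial>unit_unif)"
proof -
  define d where "d = frac c"
  have d: "0 \<le> d" "d < 1" by (auto simp: d_def frac_lt_1)
  have "h (x + c) = h (x + d)" for x
    using periodic_int[of h "x + d" "\<lfloor>c\<rfloor>", OF per] by (simp add: d_def frac_def algebra_simps)
  then have "(\<integral>\<^sup>+x. h (x + c) \<partial>unit_unif) = (\<integral>\<^sup>+x. indicator {0..<1} x * h (x + d) \<partial>lborel)"
    by (simp add: nn_integral_unit_unif)
  also have "\<dots> = (\<integral>\<^sup>+x. indicator {0..<1} (x - d) * h x \<partial>lborel)"
    by (subst nn_integral_real_affine[where c = 1 and t = "-d"]) auto
  also have "\<dots> = (\<integral>\<^sup>+x. indicator {d..<1} x * h x + indicator {1..<1+d} x * h x \<partial>lborel)"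
    using d by (intro nn_integral_cong) (auto simp: indicator_def)
  also have "\<dots> = (\<integral>\<^sup>+x. indicator {d..<1} x * h x \<partial>lborel) + (\<integral>\<^sup>+x. indicator {1..<1+d} x * h x \<partial>lborel)"
    by (rule nn_integral_add) auto
  also have "(\<integral>\<^sup>+x. indicator {1..<1+d} x * h x \<partial>lborel) = (\<integral>\<^sup>+x. indicator {0..<d} x * h x \<partial>lborel)"
    by (subst nn_integral_real_affine[where c = 1 and t = 1])
       (auto simp: add.commute[of 1] per indicator_def intro!: nn_integral_cong)
  also have "(\<integral>\<^sup>+x. indicator {d..<1} x * h x \<partial>lborel) + \<dots>
      = (\<integral>\<^sup>+x. indicator {d..<1} x * h x + indicator {0..<d} x * h x \<partial>lborel)"
    by (rule nn_integral_add[symmetric]) auto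
  also have "\<dots> = (\<integral>\<^sup>+x. indicator {0..<1} x * h x \<partial>lborel)"
    using d by (intro nn_integral_cong) (auto simp: indicator_def)
  finally show ?thesis by (simp add: nn_integral_unit_unif)
qed

text \<open>Averaging over an independent shift \<open>y\<close> turns invariance under translations into
  invariance under multiplication by a nonzero integer.\<close>

lemma nn_integral_unit_affine:
  fixes D :: int
  assumes [measurable]: "h \<in> borel_measurable borel" and per: "\<And>x. h (x + 1) = h x" and "D \<noteq> 0"
  shows "(\<integral>\<^sup>+x. h (of_int D * x + c) \<partial>unit_unif) = (\<integral>\<^sup>+x. h x \<partial>unit_unif)"
proof -
  \<comment> \<open>A shift by \<open>y\<close> after the multiplication is a shift of
    \<open>x\<close> by \<open>y / D\<close>, so this integral equals its own average over
    \<open>y\<close>.\<close>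
  have fixed: "(\<integral>\<^sup>+x. h (of_int D * x + y) \<partial>unit_unif) = (\<integral>\<^sup>+x. h (of_int D * x) \<partial>unit_unif)" for y
  proof -
    have "h (of_int D * (x + 1)) = h (of_int D * x)" for x
      using periodic_int[of h "of_int D * x" D, OF per] by (simp add: algebra_simps)
    then have "(\<integral>\<^sup>+x. h (of_int D * (x + y / of_int D)) \<partial>unit_unif) = (\<integral>\<^sup>+x. h (of_int D * x) \<partial>unit_unif)"
      by (intro nn_integral_unit_shift[where h = "\<lambda>x. h (of_int D * x)"]) auto
    then show ?thesis using \<open>D \<noteq> 0\<close> by (simp add: algebra_simps)
  qed
  have "(\<integral>\<^sup>+y. (\<integral>\<^sup>+x. h (of_int D * x + y) \<partial>unit_unif) \<partial>unit_unif)
      = (\<integral>\<^sup>+x. (\<integral>\<^sup>+y. h (of_int D * x + y) \<partial>unit_unif) \<partial>unit_unif)"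
    by (rule unit_unif2.Fubini') measurable
  also have "\<dots> = (\<integral>\<^sup>+x. (\<integral>\<^sup>+y. h y \<partial>unit_unif) \<partial>unit_unif)"
  proof (rule nn_integral_cong)
    fix x :: real
    show "(\<integral>\<^sup>+y. h (of_int D * x + y) \<partial>unit_unif) = (\<integral>\<^sup>+y. h y \<partial>unit_unif)"
      using nn_integral_unit_shift[of h "of_int D * x", OF _ per] by (simp add: add.commute)
  qed
  finally show ?thesis by (simp add: fixed)
qed

text \<open>Along a variable with nonzero coefficient the other summand acts as a shift, which the
  affine invariance absorbs.\<close>

lemma nn_integral_unit_linear_form:
  fixes q1 q2 :: int
  assumes [measurable]: "f \<in> borel_measurable borel" and per: "\<And>x. f (x + 1) = f x"
    and "(q1, q2) \<noteq> (0, 0)"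
  shows "(\<integral>\<^sup>+z. f (of_int q1 * fst z + of_int q2 * snd z) \<partial>(unit_unif \<Otimes>\<^sub>M unit_unif))
       = (\<integral>\<^sup>+x. f x \<partial>unit_unif)"
proof -
  have "(\<integral>\<^sup>+z. f (of_int q1 * fst z + of_int q2 * snd z) \<partial>(unit_unif \<Otimes>\<^sub>M unit_unif))
      = (\<integral>\<^sup>+x. (\<integral>\<^sup>+y. f (of_int q1 * x + of_int q2 * y) \<partial>unit_unif) \<partial>unit_unif)"
    by (subst unit_unif.nn_integral_fst[symmetric]) auto
  also have "\<dots> = (\<integral>\<^sup>+x. f x \<partial>unit_unif)"
  proof (cases "q2 = 0")
    case True
    then show ?thesis using assms(3) nn_integral_unit_affine[of f q1 0, OF _ per]
      by simp
  next
    case False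
    then show ?thesis using nn_integral_unit_affine[of f q2, OF _ per]
      by (simp add: add.commute)
  qed
  finally show ?thesis .
qed

text \<open>Substituting \<open>x \<mapsto> n x\<close> and then \<open>y \<mapsto> y - k x\<close> makes the first form independent of \<open>x\<close>,
  while the second form becomes \<open>(k' n - m k) x + m y\<close>.\<close>

lemma nn_integral_unit_linear_forms:
  fixes k n k' m :: int
  assumes [measurable]: "f \<in> borel_measurable borel" "g \<in> borel_measurable borel"
    and per: "\<And>x. f (x + 1) = f x" "\<And>x. g (x + 1) = g x"
    and "n \<noteq> 0" "k' * n \<noteq> m * k"
  shows "(\<integral>\<^sup>+z. f (of_int k * fst z + of_int n * snd z) * g (of_int k' * fst z + of_int m * snd z)
           \<partial>(unit_unif \<Otimes>\<^sub>M unit_unif))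
       = (\<integral>\<^sup>+x. f x \<partial>unit_unif) * (\<integral>\<^sup>+x. g x \<partial>unit_unif)"
proof -
  define F where "F x y = f (of_int k * x + of_int n * y) * g (of_int k' * x + of_int m * y)" for x y :: real
  \<comment> \<open>Up to sign, the determinant of the two coefficient vectors.\<close>
  define D where "D = k' * n - m * k"
  have "D \<noteq> 0" using assms by (simp add: D_def)
  have [measurable]: "case_prod F \<in> borel_measurable (borel \<Otimes>\<^sub>M borel)"
    unfolding F_def by measurable
  have perx: "F (x + 1) y = F x y" for x y
    using periodic_int[of f "of_int k * x + of_int n * y" k, OF per(1)]
      periodic_int[of g "of_int k' * x + of_int m * y" k', OF per(2)]
    by (simp add: F_def algebra_simps)
  have pery: "F x (y + 1) = F x y" for x y
    using periodic_int[of f "of_int k * x + of_int n * y" n, OF per(1)]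
      periodic_int[of g "of_int k' * x + of_int m * y" m, OF per(2)]
    by (simp add: F_def algebra_simps)
  have "(\<integral>\<^sup>+z. f (of_int k * fst z + of_int n * snd z) * g (of_int k' * fst z + of_int m * snd z)
           \<partial>(unit_unif \<Otimes>\<^sub>M unit_unif)) = (\<integral>\<^sup>+x. (\<integral>\<^sup>+y. F x y \<partial>unit_unif) \<partial>unit_unif)"
    by (subst unit_unif.nn_integral_fst[symmetric]) (auto simp: F_def[abs_def])
  also have "\<dots> = (\<integral>\<^sup>+x. (\<integral>\<^sup>+y. F (of_int n * x) y \<partial>unit_unif) \<partial>unit_unif)"
    using nn_integral_unit_affine[of "\<lambda>x. (\<integral>\<^sup>+y. F x y \<partial>unit_unif)" n 0] \<open>n \<noteq> 0\<close>
    by (simp add: perx)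
  also have "\<dots> = (\<integral>\<^sup>+x. (\<integral>\<^sup>+y. F (of_int n * x) (y + (- of_int k * x)) \<partial>unit_unif) \<partial>unit_unif)"
    by (intro nn_integral_cong nn_integral_unit_shift[symmetric]) (auto simp: pery)
  also have "\<dots> = (\<integral>\<^sup>+x. (\<integral>\<^sup>+y. f (of_int n * y) * g (of_int D * x + of_int m * y) \<partial>unit_unif) \<partial>unit_unif)"
    by (simp add: F_def D_def algebra_simps)
  also have "\<dots> = (\<integral>\<^sup>+y. (\<integral>\<^sup>+x. f (of_int n * y) * g (of_int D * x + of_int m * y) \<partial>unit_unif) \<partial>unit_unif)"
    by (rule unit_unif2.Fubini') measurable
  also have "\<dots> = (\<integral>\<^sup>+y. f (of_int n * y) * (\<integral>\<^sup>+x. g x \<partial>unit_unif) \<partial>unit_unif)"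
    by (simp add: nn_integral_cmult nn_integral_unit_affine[of g D] per \<open>D \<noteq> 0\<close>)
  also have "\<dots> = (\<integral>\<^sup>+x. f x \<partial>unit_unif) * (\<integral>\<^sup>+x. g x \<partial>unit_unif)"
    using nn_integral_unit_affine[of f n 0] \<open>n \<noteq> 0\<close> by (simp add: nn_integral_multc per)
  finally show ?thesis .
qed

section \<open>Arcs on the circle and their measure\<close>

text \<open>The closed arc of radius \<open>s\<close> about \<open>c\<close> on the circle, lifted
  to a 1-periodic subset of the line.\<close>

definition near_int :: "real \<Rightarrow> real \<Rightarrow> real set" where
  "near_int c s = {x. \<exists>p::int. \<bar>x - of_int p - c\<bar> \<le> s}"

lemma near_int_measurable [measurable]: "near_int c s \<in> sets borel"
  unfolding near_int_def by measurable

lemma near_int_periodic: "x + 1 \<in> near_int c s \<longleftrightarrow> x \<in> near_int c s"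
proof -
  have "(\<exists>p::int. \<bar>x + 1 - of_int p - c\<bar> \<le> s) \<longleftrightarrow> (\<exists>p::int. \<bar>x - of_int p - c\<bar> \<le> s)"
  proof
    assume "\<exists>p::int. \<bar>x + 1 - of_int p - c\<bar> \<le> s"
    then obtain p :: int where "\<bar>x + 1 - of_int p - c\<bar> \<le> s" ..
    then show "\<exists>p::int. \<bar>x - of_int p - c\<bar> \<le> s" by (intro exI[of _ "p - 1"]) (simp add: algebra_simps)
  next
    assume "\<exists>p::int. \<bar>x - of_int p - c\<bar> \<le> s"
    then obtain p :: int where "\<bar>x - of_int p - c\<bar> \<le> s" ..
    then show "\<exists>p::int. \<bar>x + 1 - of_int p - c\<bar> \<le> s" by (intro exI[of _ "p + 1"]) (simp add: algebra_simps)
  qed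
  then show ?thesis by (simp add: near_int_def)
qed

lemma indicator_near_int_periodic:
  "(indicator (near_int c s) (x + 1) :: ennreal) = indicator (near_int c s) x"
  by (simp add: indicator_def near_int_periodic)

text \<open>Translation invariance moves the centre to 1/2, where an arc of radius below 1/2 does
  not wrap around the ends of [0, 1).\<close>

lemma emeasure_near_int_center:
  "emeasure unit_unif (near_int c s) = emeasure unit_unif (near_int (1/2) s)"
proof -
  have "x + (c - 1/2) \<in> near_int c s \<longleftrightarrow> x \<in> near_int (1/2) s" for x
    by (simp add: near_int_def algebra_simps)
  then have "(indicator (near_int c s) (x + (c - 1/2)) :: ennreal) = indicator (near_int (1/2) s) x" for x
    by (simp add: indicator_def)
  then show ?thesis
    using nn_integral_unit_shift[of "indicator (near_int c s)" "c - 1/2"]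
    by (simp add: indicator_near_int_periodic)
qed

lemma emeasure_near_int:
  assumes "0 \<le> s" "s \<le> 1/2"
  shows "emeasure unit_unif (near_int c s) = ennreal (2 * s)"
proof -
  \<comment> \<open>The end points matter only for \<open>s = 1/2\<close>: the closed interval is
    then [0, 1], and at \<open>x = 0\<close> two values of \<open>p\<close> qualify.\<close>
  have "AE x in lborel. x \<noteq> 0 \<and> x \<noteq> (1::real)"
    using AE_lborel_singleton[of 0] AE_lborel_singleton[of "1::real"] by eventually_elim auto
  moreover have "x \<in> {0..<1} \<and> x \<in> near_int (1/2) s \<longleftrightarrow> x \<in> {1/2 - s..1/2 + s}"
    if "x \<noteq> 0 \<and> x \<noteq> 1" for x :: real
  proof
    assume x: "x \<in> {0..<1} \<and> x \<in> near_int (1/2) s"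
    then obtain p :: int where p: "\<bar>x - of_int p - 1/2\<bar> \<le> s" by (auto simp: near_int_def)
    have "- 1 < real_of_int p" "real_of_int p < 1"
      using p x assms that by (auto simp: abs_le_iff)
    then have "p = 0" by linarith
    then show "x \<in> {1/2 - s..1/2 + s}" using p by (auto simp: abs_le_iff)
  next
    assume "x \<in> {1/2 - s..1/2 + s}"
    then show "x \<in> {0..<1} \<and> x \<in> near_int (1/2) s" using assms that
      by (auto simp: near_int_def abs_le_iff intro!: exI[of _ 0])
  qed
  ultimately have "AE x in lborel. (indicator {0..<1} x * indicator (near_int (1/2) s) x :: ennreal)
      = indicator {1/2 - s..1/2 + s} x"
    by (elim AE_mp) (intro AE_I2 impI, auto simp: indicator_def split: if_splits)
  then have "(\<integral>\<^sup>+x. indicator {0..<1} x * indicator (near_int (1/2) s) x \<partial>lborel)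
      = (\<integral>\<^sup>+x. indicator {1/2 - s..1/2 + s} x \<partial>lborel)"
    by (rule nn_integral_cong_AE)
  then show ?thesis
    using assms by (simp add: emeasure_near_int_center[of c] nn_integral_unit_unif[symmetric])
qed

lemma emeasure_near_int_le:
  assumes "0 \<le> s"
  shows "emeasure unit_unif (near_int c s) \<le> ennreal (2 * s)"
proof (cases "s \<le> 1/2")
  case False
  then have "1 \<le> ennreal (2 * s)" by simp
  then show ?thesis using unit_unif.emeasure_le_1 order_trans by blast
qed (simp add: emeasure_near_int assms)

section \<open>Overlaps of parallel vectors\<close>

lemma dist_int_le: "dist_int x \<le> \<bar>x - of_int n\<bar>"
  unfolding dist_int_def by (rule round_diff_minimal)

lemma card_int_near_le:
  fixes \<theta> \<Delta> :: real
  assumes "0 \<le> \<Delta>"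
  shows "finite {j::int. \<bar>\<theta> + of_int j\<bar> \<le> \<Delta>}" "real (card {j::int. \<bar>\<theta> + of_int j\<bar> \<le> \<Delta>}) \<le> 2 * \<Delta> + 1"
proof -
  have sub: "{j::int. \<bar>\<theta> + of_int j\<bar> \<le> \<Delta>} \<subseteq> {\<lceil>- \<theta> - \<Delta>\<rceil>..\<lfloor>- \<theta> + \<Delta>\<rfloor>}"
    by (auto simp: abs_le_iff le_floor_iff ceiling_le_iff)
  then show "finite {j::int. \<bar>\<theta> + of_int j\<bar> \<le> \<Delta>}" by (rule finite_subset) simp
  have "card {j::int. \<bar>\<theta> + of_int j\<bar> \<le> \<Delta>} \<le> nat (\<lfloor>- \<theta> + \<Delta>\<rfloor> - \<lceil>- \<theta> - \<Delta>\<rceil> + 1)"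
    using card_mono[OF _ sub] by simp
  also have "real \<dots> \<le> 2 * \<Delta> + 1"
    using assms by (cases "\<lfloor>- \<theta> + \<Delta>\<rfloor> - \<lceil>- \<theta> - \<Delta>\<rceil> + 1 \<ge> 0") (simp_all, linarith+)
  finally show "real (card {j::int. \<bar>\<theta> + of_int j\<bar> \<le> \<Delta>}) \<le> 2 * \<Delta> + 1" by simp
qed

text \<open>Eliminating \<open>x\<close> from a x = p + c + O(s) and b x = r + c + O(t) puts (b - a)
  c + (b p - a r) within \<open>\<Delta>\<close> of 0. The second condition describes arcs of radius
  \<open>t / b\<close> about \<open>(c + r) / b\<close>, and at most \<open>2 * \<Delta> + 1\<close>
  residues \<open>r\<close> modulo \<open>b\<close> are compatible with the first.\<close>

lemma emeasure_near_int_overlap_le: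
  fixes a b :: nat and c s t :: real
  assumes cop: "coprime a b" and "0 < b" and "0 \<le> s" "0 \<le> t"
  defines "\<Delta> \<equiv> real b * s + real a * t"
  shows "emeasure unit_unif {x. real a * x \<in> near_int c s \<and> real b * x \<in> near_int c t}
    \<le> ennreal (if dist_int ((real b - real a) * c) \<le> \<Delta> then 2 * t / real b * (2 * \<Delta> + 1) else 0)"
proof -
  define \<theta> where "\<theta> = (real b - real a) * c"
  define good where "good r p \<longleftrightarrow> \<bar>\<theta> + of_int (int b * p - int a * r)\<bar> \<le> \<Delta>" for r p :: int
  define R where "R = {r \<in> {0..<int b}. \<exists>p. good r p}"
  have \<Delta>: "0 \<le> \<Delta>" using assms by (simp add: \<Delta>_def)
  have finR: "finite R" by (rule finite_subset[of _ "{0..<int b}"]) (auto simp: R_def)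
  have sub: "{x. real a * x \<in> near_int c s \<and> real b * x \<in> near_int c t}
      \<subseteq> (\<Union>r\<in>R. near_int ((c + of_int r) / real b) (t / real b))"
  proof
    fix x assume "x \<in> {x. real a * x \<in> near_int c s \<and> real b * x \<in> near_int c t}"
    then obtain p r :: int where p: "\<bar>real a * x - of_int p - c\<bar> \<le> s"
      and r: "\<bar>real b * x - of_int r - c\<bar> \<le> t" by (auto simp: near_int_def)
    \<comment> \<open>Reducing \<open>r\<close> modulo \<open>b\<close> while replacing
      \<open>p\<close> by \<open>p - a * k\<close> leaves b p - a r unchanged.\<close>
    define r0 k where "r0 = r mod int b" and "k = r div int b"
    have rk: "r = int b * k + r0" by (simp add: r0_def k_def)
    have eq: "\<theta> + of_int (int b * (p - int a * k) - int a * r0)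
        = real a * (real b * x - of_int r - c) - real b * (real a * x - of_int p - c)"
      by (simp add: \<theta>_def rk algebra_simps)
    have "\<bar>real a * (real b * x - of_int r - c) - real b * (real a * x - of_int p - c)\<bar>
        \<le> real a * \<bar>real b * x - of_int r - c\<bar> + real b * \<bar>real a * x - of_int p - c\<bar>"
      by (rule order_trans[OF abs_triangle_ineq4]) (simp add: abs_mult)
    also have "\<dots> \<le> real a * t + real b * s"
      using p r by (intro add_mono mult_left_mono) auto
    finally have "good r0 (p - int a * k)"
      unfolding good_def eq \<Delta>_def by simp
    then have "r0 \<in> R" using \<open>0 < b\<close> by (auto simp: R_def r0_def)
    moreover have "x - of_int k - (c + of_int r0) / real b = (real b * x - of_int r - c) / real b"
      using \<open>0 < b\<close> by (simp add: rk field_simps)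
    then have "\<bar>x - of_int k - (c + of_int r0) / real b\<bar> \<le> t / real b"
      using r \<open>0 < b\<close> by (simp add: abs_divide divide_right_mono)
    then have "x \<in> near_int ((c + of_int r0) / real b) (t / real b)"
      by (auto simp: near_int_def)
    ultimately show "x \<in> (\<Union>r\<in>R. near_int ((c + of_int r) / real b) (t / real b))" by blast
  qed
  have "emeasure unit_unif {x. real a * x \<in> near_int c s \<and> real b * x \<in> near_int c t}
      \<le> emeasure unit_unif (\<Union>r\<in>R. near_int ((c + of_int r) / real b) (t / real b))"
    by (rule emeasure_mono[OF sub]) (auto intro!: sets.finite_UN finR)
  also have "\<dots> \<le> (\<Sum>r\<in>R. emeasure unit_unif (near_int ((c + of_int r) / real b) (t / real b)))"
    by (rule emeasure_subadditive_finite[OF finR]) auto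
  also have "\<dots> \<le> (\<Sum>r\<in>R. ennreal (2 * (t / real b)))"
    using assms by (intro sum_mono emeasure_near_int_le) simp
  also have "\<dots> = ennreal (real (card R) * (2 * (t / real b)))"
    using assms by (simp add: ennreal_of_nat_eq_real_of_nat ennreal_mult[symmetric])
  also have "\<dots> \<le> ennreal (if dist_int \<theta> \<le> \<Delta> then 2 * t / real b * (2 * \<Delta> + 1) else 0)"
  proof (rule ennreal_leI)
    define P where "P r = (SOME p. good r p)" for r
    have P: "good r (P r)" if "r \<in> R" for r
      using that unfolding R_def P_def by (auto intro: someI_ex)
    \<comment> \<open>By coprimality the integer b p - a r determines \<open>r\<close> modulo
      \<open>b\<close>, so residues are counted by integers within \<open>\<Delta>\<close> of
      \<open>- \<theta>\<close>.\<close>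
    have inj: "inj_on (\<lambda>r. int b * P r - int a * r) R"
    proof
      fix r r' assume rr: "r \<in> R" "r' \<in> R" and "int b * P r - int a * r = int b * P r' - int a * r'"
      then have "int a * (r - r') = int b * (P r - P r')" by (simp add: algebra_simps)
      then have "int b dvd int a * (r - r')" by simp
      moreover have "coprime (int b) (int a)" using cop by (simp add: coprime_commute)
      ultimately have "int b dvd r - r'" by (simp add: coprime_dvd_mult_right_iff)
      then have "r mod int b = r' mod int b" by (simp add: mod_eq_dvd_iff)
      then show "r = r'" using rr by (simp add: R_def)
    qed
    have img: "(\<lambda>r. int b * P r - int a * r) ` R \<subseteq> {j::int. \<bar>\<theta> + of_int j\<bar> \<le> \<Delta>}"
      using P by (auto simp: good_def)
    have "card R \<le> card {j::int. \<bar>\<theta> + of_int j\<bar> \<le> \<Delta>}"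
      using card_inj_on_le[OF inj img card_int_near_le(1)[OF \<Delta>]] .
    then have card: "real (card R) \<le> 2 * \<Delta> + 1"
      using card_int_near_le(2)[OF \<Delta>, of \<theta>] by linarith
    have "R = {}" if "\<not> dist_int \<theta> \<le> \<Delta>"
    proof (rule ccontr)
      assume "R \<noteq> {}"
      then obtain r p where "good r p" by (auto simp: R_def)
      then have "\<bar>\<theta> - of_int (int a * r - int b * p)\<bar> \<le> \<Delta>" by (simp add: good_def algebra_simps)
      then show False using that dist_int_le[of \<theta> "int a * r - int b * p"] by linarith
    qed
    moreover have "real (card R) * (2 * (t / real b)) \<le> (2 * \<Delta> + 1) * (2 * (t / real b))"
      using card assms by (intro mult_right_mono) auto
    ultimately show "real (card R) * (2 * (t / real b)) \<le> (if dist_int \<theta> \<le> \<Delta> then 2 * t / real b * (2 * \<Delta> + 1) else 0)"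
      by (auto simp: mult.commute)
  qed
  finally show ?thesis by (simp add: \<theta>_def)
qed

section \<open>Events cut out by linear forms on the unit square\<close>

abbreviation unit_square :: "(real \<times> real) measure" where
  "unit_square \<equiv> unit_unif \<Otimes>\<^sub>M unit_unif"

definition form_near :: "real \<Rightarrow> real \<Rightarrow> int \<Rightarrow> int \<Rightarrow> (real \<times> real) set" where
  "form_near c s q1 q2 = {z. of_int q1 * fst z + of_int q2 * snd z \<in> near_int c s}"

lemma space_unit_square [simp]: "space unit_square = UNIV"
  by (simp add: space_pair_measure)

lemma form_near_measurable [measurable]: "form_near c s q1 q2 \<in> sets unit_square"
proof -
  have "Measurable.pred unit_square (\<lambda>z. of_int q1 * fst z + of_int q2 * snd z \<in> near_int c s)"
    by measurable
  then show ?thesis by (simp add: form_near_def Measurable.pred_def)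
qed

lemma emeasure_form_near:
  assumes "(q1, q2) \<noteq> (0, 0)"
  shows "emeasure unit_square (form_near c s q1 q2) = emeasure unit_unif (near_int c s)"
proof -
  have "emeasure unit_square (form_near c s q1 q2)
      = (\<integral>\<^sup>+z. indicator (near_int c s) (of_int q1 * fst z + of_int q2 * snd z) \<partial>unit_square)"
    unfolding nn_integral_indicator[symmetric, OF form_near_measurable]
    by (rule nn_integral_cong) (simp add: form_near_def indicator_def)
  then show ?thesis
    using nn_integral_unit_linear_form[of "indicator (near_int c s)" q1 q2] assms
    by (simp add: indicator_near_int_periodic)
qed

lemma emeasure_form_near_Int:
  assumes "n \<noteq> 0" "k' * n \<noteq> m * k"
  shows "emeasure unit_square (form_near c s k n \<inter> form_near c t k' m)
    = emeasure unit_unif (near_int c s) * emeasure unit_unif (near_int c t)"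
proof -
  have "emeasure unit_square (form_near c s k n \<inter> form_near c t k' m)
      = (\<integral>\<^sup>+z. indicator (near_int c s) (of_int k * fst z + of_int n * snd z)
           * indicator (near_int c t) (of_int k' * fst z + of_int m * snd z) \<partial>unit_square)"
    unfolding nn_integral_indicator[symmetric, OF sets.Int[OF form_near_measurable form_near_measurable]]
    by (rule nn_integral_cong) (auto simp: form_near_def indicator_def)
  then show ?thesis
    using nn_integral_unit_linear_forms[of "indicator (near_int c s)" "indicator (near_int c t)" n k' m k] assms
    by (simp add: indicator_near_int_periodic)
qed

text \<open>Both conditions depend only on the form with coefficients \<open>q1\<close>,
  \<open>q2\<close>, whose value is uniformly distributed modulo 1.\<close>

lemma emeasure_form_near_Int_parallel:
  fixes a b :: nat
  assumes "(q1, q2) \<noteq> (0, 0)"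
  shows "emeasure unit_square (form_near c s (int a * q1) (int a * q2) \<inter> form_near c t (int b * q1) (int b * q2))
    = emeasure unit_unif {x. real a * x \<in> near_int c s \<and> real b * x \<in> near_int c t}"
proof -
  define X where "X = {x. real a * x \<in> near_int c s \<and> real b * x \<in> near_int c t}"
  have X [measurable]: "X \<in> sets borel" unfolding X_def by measurable
  have per: "real a * (x + 1) \<in> near_int e r \<longleftrightarrow> real a * x \<in> near_int e r" for a :: nat and x e r
    using periodic_int[of "\<lambda>x. x \<in> near_int e r" "real a * x" "int a"] near_int_periodic
    by (simp add: algebra_simps)
  have "emeasure unit_square (form_near c s (int a * q1) (int a * q2) \<inter> form_near c t (int b * q1) (int b * q2))
      = (\<integral>\<^sup>+z. indicator X (of_int q1 * fst z + of_int q2 * snd z) \<partial>unit_square)"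
    unfolding nn_integral_indicator[symmetric, OF sets.Int[OF form_near_measurable form_near_measurable]]
    by (rule nn_integral_cong) (auto simp: form_near_def X_def indicator_def distrib_left mult.assoc)
  also have "\<dots> = emeasure unit_unif X"
  proof -
    have "(indicator X (x + 1) :: ennreal) = indicator X x" for x
      using per by (simp add: X_def indicator_def)
    then show ?thesis
      using nn_integral_unit_linear_form[of "indicator X" q1 q2] assms by simp
  qed
  finally show ?thesis by (simp add: X_def)
qed

lemma not_liouville_lower_bound:
  assumes "\<gamma> \<notin> \<rat>" "\<not> liouville_number \<gamma>"
  obtains c :: real and \<eta> :: nat where "0 < c" "\<And>k. 1 \<le> k \<Longrightarrow> c / real k ^ \<eta> \<le> dist_int (real k * \<gamma>)"
proof -
  obtain \<eta> where "\<And>q::nat. 2 \<le> q \<Longrightarrow> \<not> dist_int (real q * \<gamma>) \<le> 1 / real q ^ \<eta>"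
    using assms(2) unfolding liouville_number_def by blast
  then have \<eta>: "\<And>q::nat. 2 \<le> q \<Longrightarrow> 1 / real q ^ \<eta> < dist_int (real q * \<gamma>)"
    by (simp add: not_le)
  have "\<gamma> \<noteq> of_int (round \<gamma>)" using assms(1) by (metis Rats_of_int)
  then have pos: "0 < dist_int \<gamma>" by (simp add: dist_int_def)
  show ?thesis
  proof
    \<comment> \<open>The Liouville condition concerns \<open>q \<ge> 2\<close> only; at
      \<open>k = 1\<close> irrationality supplies the positive constant
      \<open>dist_int \<gamma>\<close>.\<close>
    show "0 < min 1 (dist_int \<gamma>)" using pos by simp
    fix k :: nat assume k: "1 \<le> k"
    show "min 1 (dist_int \<gamma>) / real k ^ \<eta> \<le> dist_int (real k * \<gamma>)"
    proof (cases "k = 1")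
      case False
      then have "1 / real k ^ \<eta> < dist_int (real k * \<gamma>)" using k by (intro \<eta>) auto
      moreover have "min 1 (dist_int \<gamma>) / real k ^ \<eta> \<le> 1 / real k ^ \<eta>"
        by (intro divide_right_mono) auto
      ultimately show ?thesis by linarith
    qed simp
  qed
qed

text \<open>The bound of \<open>emeasure_near_int_overlap_le\<close> for the radii
  \<open>\<phi> n\<close> and \<open>\<phi> m\<close>, with the ratio n : m reduced to a :
  b.\<close>

definition parallel_overlap :: "real \<Rightarrow> (nat \<Rightarrow> real) \<Rightarrow> nat \<Rightarrow> nat \<Rightarrow> real" where
  "parallel_overlap \<gamma> \<phi> n m =
     (let a = n div gcd n m; b = m div gcd n m; \<Delta> = real b * \<phi> n + real a * \<phi> m
      in if dist_int ((real b - real a) * \<gamma>) \<le> \<Delta> then 2 * \<phi> m / real b * (2 * \<Delta> + 1) else 0)"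

lemma parallel_overlap_nonneg:
  assumes "0 \<le> \<phi> n" "0 \<le> \<phi> m"
  shows "0 \<le> parallel_overlap \<gamma> \<phi> n m"
  using assms by (simp add: parallel_overlap_def Let_def)

text \<open>Parallel vectors \<open>(k, n)\<close> and \<open>(l, m)\<close> are the multiples by
  \<open>a\<close> and \<open>b\<close> of one vector \<open>(j, d)\<close> with
  \<open>d = gcd n m\<close>, which reduces the overlap to one variable.\<close>

lemma emeasure_form_near_Int_le_parallel_overlap:
  assumes "0 < n" "0 < m" "l * n = m * k" "0 \<le> \<phi> n" "0 \<le> \<phi> m"
  shows "emeasure unit_square (form_near \<gamma> (\<phi> n) (int k) (int n) \<inter> form_near \<gamma> (\<phi> m) (int l) (int m))
    \<le> ennreal (parallel_overlap \<gamma> \<phi> n m)"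
proof -
  define d a b where "d = gcd n m" and "a = n div d" and "b = m div d"
  have d: "0 < d" "n = a * d" "m = b * d" using assms by (auto simp: d_def a_def b_def)
  have "0 < b" using d assms by (auto intro: Nat.gr0I)
  have cop: "coprime a b" using assms by (auto simp: a_def b_def d_def intro: div_gcd_coprime)
  have lk: "l * a = b * k" using assms(3) d by simp
  then have "a dvd b * k" by (metis dvd_triv_right)
  then have "a dvd k" using cop by (simp add: coprime_dvd_mult_right_iff)
  then obtain j where j: "k = a * j" by blast
  have "0 < a" using d assms by (auto intro: Nat.gr0I)
  have "l = b * j" using lk j \<open>0 < a\<close> by simp
  then have "emeasure unit_square (form_near \<gamma> (\<phi> n) (int k) (int n) \<inter> form_near \<gamma> (\<phi> m) (int l) (int m))
      = emeasure unit_unif {x. real a * x \<in> near_int \<gamma> (\<phi> n) \<and> real b * x \<in> near_int \<gamma> (\<phi> m)}"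
    using emeasure_form_near_Int_parallel[of "int j" "int d" \<gamma> "\<phi> n" a "\<phi> m" b] d j by simp
  also have "\<dots> \<le> ennreal (parallel_overlap \<gamma> \<phi> n m)"
    using emeasure_near_int_overlap_le[OF cop \<open>0 < b\<close> assms(4,5), of \<gamma>]
    unfolding parallel_overlap_def Let_def a_def b_def d_def .
  finally show ?thesis .
qed

text \<open>Dividing by the gcd \<open>d\<close> shows that the pairs are
  \<open>(a * j, b * j)\<close> with \<open>1 \<le> j \<le> d\<close>.\<close>

lemma card_parallel_le:
  fixes n m :: nat
  assumes "0 < n" "0 < m"
  shows "card {(k, l). k \<in> {1..n} \<and> l \<in> {1..m} \<and> l * n = m * k} \<le> gcd n m"
proof -
  define d a b where "d = gcd n m" and "a = n div d" and "b = m div d"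
  have d: "0 < d" "n = a * d" "m = b * d" using assms by (auto simp: d_def a_def b_def)
  have "0 < a" using d assms by (auto intro: Nat.gr0I)
  have cop: "coprime a b" using assms by (auto simp: a_def b_def d_def intro: div_gcd_coprime)
  have "{(k, l). k \<in> {1..n} \<and> l \<in> {1..m} \<and> l * n = m * k} \<subseteq> (\<lambda>j. (a * j, b * j)) ` {1..d}"
  proof safe
    fix k l assume kl: "k \<in> {1..n}" "l \<in> {1..m}" "l * n = m * k"
    have lk: "l * a = b * k" using kl(3) d by simp
    then have "a dvd b * k" by (metis dvd_triv_right)
    then have "a dvd k" using cop by (simp add: coprime_dvd_mult_right_iff)
    then obtain j where j: "k = a * j" by blast
    have "l = b * j" using lk j \<open>0 < a\<close> by simp
    moreover have "j \<in> {1..d}" using kl(1) j d \<open>0 < a\<close> by (auto intro: Nat.gr0I simp: Suc_le_eq)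
    ultimately show "(k, l) \<in> (\<lambda>j. (a * j, b * j)) ` {1..d}" using j by blast
  qed
  then have "card {(k, l). k \<in> {1..n} \<and> l \<in> {1..m} \<and> l * n = m * k} \<le> card {1..d}"
    by (rule surj_card_le[rotated]) simp
  then show ?thesis by (simp add: d_def)
qed

text \<open>Two overlapping intervals of a parallel pair force \<open>\<parallel>(b - a) \<gamma>\<parallel> \<le> \<Delta> \<le> b / d\<close>; since \<open>\<gamma>\<close> is not
  Liouville, this gives \<open>m = b d \<le> K b ^ h\<close>, i.e. the reduced denominator is at least a power of \<open>m\<close>.\<close>

lemma sum_parallel_overlap_le:
  fixes \<gamma> :: real and \<phi> :: "nat \<Rightarrow> real"
  assumes "\<gamma> \<notin> \<rat>" "\<not> liouville_number \<gamma>"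
    and \<phi>: "\<And>n. 1 \<le> n \<Longrightarrow> 0 \<le> \<phi> n" "\<And>n. 1 \<le> n \<Longrightarrow> \<phi> n \<le> 1 / (2 * real n)"
  shows "\<exists>B\<ge>0. \<forall>m\<ge>1. (\<Sum>n\<in>{1..<m}. real (gcd n m) * parallel_overlap \<gamma> \<phi> n m) \<le> B * (real m * \<phi> m)"
proof -
  obtain c \<eta> where c: "0 < c" "\<And>k. 1 \<le> k \<Longrightarrow> c / real k ^ \<eta> \<le> dist_int (real k * \<gamma>)"
    using not_liouville_lower_bound[OF assms(1,2)] by metis
  \<comment> \<open>The lower bound will give \<open>c * d \<le> b ^ (\<eta> + 1)\<close>; one more
    factor \<open>b\<close> turns \<open>d\<close> into \<open>m = b * d\<close>.\<close>
  define K h where "K = 1 / c" and "h = \<eta> + 2"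
  obtain B where B: "0 \<le> B" "\<And>m. 0 < m \<Longrightarrow> (\<Sum>n | n \<in> {1..<m} \<and> real m \<le> K * real (m div gcd n m) ^ h.
        (real (gcd n m) / real m)\<^sup>2) \<le> B"
    using sum_gcd_squares_le[of h K] c(1) by (auto simp: h_def K_def)
  \<comment> \<open>In the factor \<open>2 * \<Delta> + 1\<close>, the first term yields
    \<open>4 * \<phi> m\<close> because \<open>\<Delta> \<le> b / d\<close>; the 1 yields the rest
    because d / b = m (d / m)^2.\<close>
  have term_le: "real (gcd n m) * parallel_overlap \<gamma> \<phi> n m \<le>
      4 * \<phi> m + 2 * real m * \<phi> m * (if real m \<le> K * real (m div gcd n m) ^ h then (real (gcd n m) / real m)\<^sup>2 else 0)"
    if n: "n \<in> {1..<m}" for n m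
  proof -
    define d a b where "d = gcd n m" and "a = n div d" and "b = m div d"
    define \<Delta> where "\<Delta> = real b * \<phi> n + real a * \<phi> m"
    have d: "0 < d" "n = a * d" "m = b * d" using n by (auto simp: d_def a_def b_def)
    have a: "0 < a" using d n by (auto intro: Nat.gr0I)
    have ab: "a < b" using d n by auto
    then have b: "0 < b" by simp
    have m: "0 \<le> \<phi> m" "0 < m" using n \<phi>(1)[of m] by auto
    show ?thesis
    proof (cases "dist_int ((real b - real a) * \<gamma>) \<le> \<Delta>")
      case True
      \<comment> \<open>The cap on \<open>\<phi>\<close> bounds each summand of
        \<open>\<Delta>\<close> by \<open>b / (2 * d)\<close>.\<close>
      have "real b * \<phi> n \<le> real b * (1 / (2 * real n))" using \<phi>(2)[of n] n by (intro mult_left_mono) auto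
      also have "\<dots> = (real b / (2 * real d)) / real a" using d by simp
      also have "\<dots> \<le> (real b / (2 * real d)) / 1" using a by (intro divide_left_mono) auto
      finally have 1: "real b * \<phi> n \<le> real b / (2 * real d)" by simp
      have "real a * \<phi> m \<le> real b * (1 / (2 * real m))"
        using \<phi>(2)[of m] n ab m by (intro mult_mono) auto
      also have "\<dots> = 1 / (2 * real d)" using d b by simp
      also have "\<dots> \<le> real b / (2 * real d)" using b d(1) by (intro divide_right_mono) auto
      finally have \<Delta>d: "\<Delta> \<le> real b / real d" using 1 unfolding \<Delta>_def by (simp add: field_simps)
      \<comment> \<open>As \<open>n < m\<close>, the difference \<open>b - a\<close> lies between 1
        and \<open>b\<close>, so the lower bound applies to it and weakens to one in
        \<open>b\<close>.\<close>
      have "c / real b ^ \<eta> \<le> c / real (b - a) ^ \<eta>"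
        using c(1) ab by (intro divide_left_mono power_mono mult_pos_pos zero_less_power) auto
      also have "\<dots> \<le> dist_int (real (b - a) * \<gamma>)" using ab by (intro c(2)) auto
      also have "\<dots> \<le> real b / real d" using True \<Delta>d ab by (simp add: of_nat_diff)
      finally have "c * real d \<le> real b * real b ^ \<eta>" using b d(1) by (simp add: field_simps)
      then have "real b * (c * real d) \<le> real b * (real b * real b ^ \<eta>)" by (intro mult_left_mono) auto
      then have "real m \<le> K * real b ^ h"
        using c(1) d(3) by (simp add: K_def h_def field_simps)
      have "real d * parallel_overlap \<gamma> \<phi> n m = 2 * \<phi> m * real d / real b * (2 * \<Delta> + 1)"
        using True by (simp add: parallel_overlap_def Let_def flip: d_def a_def b_def \<Delta>_def)
      also have "\<dots> \<le> 2 * \<phi> m * real d / real b * (2 * (real b / real d) + 1)"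
        using m \<Delta>d by (intro mult_left_mono) auto
      also have "\<dots> = 4 * \<phi> m + 2 * \<phi> m * real d / real b"
        using b d(1) by (simp add: field_simps)
      also have "\<dots> = 4 * \<phi> m + 2 * real m * \<phi> m * (real d / real m)\<^sup>2"
        using b d(1) by (simp add: d(3) field_simps power2_eq_square)
      finally show ?thesis using \<open>real m \<le> K * real b ^ h\<close> by (simp flip: d_def b_def)
    qed (use m in \<open>simp add: parallel_overlap_def Let_def flip: d_def a_def b_def \<Delta>_def\<close>)
  qed
  show ?thesis
  proof (intro exI[of _ "4 + 2 * B"] conjI allI impI)
    show "0 \<le> 4 + 2 * B" using B(1) by simp
    fix m :: nat assume m: "1 \<le> m"
    have filter: "(\<Sum>n | n \<in> {1..<m} \<and> real m \<le> K * real (m div gcd n m) ^ h. (real (gcd n m) / real m)\<^sup>2)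
        = (\<Sum>n\<in>{1..<m}. if real m \<le> K * real (m div gcd n m) ^ h then (real (gcd n m) / real m)\<^sup>2 else 0)"
      by (rule sum.inter_filter) simp
    have "(\<Sum>n\<in>{1..<m}. real (gcd n m) * parallel_overlap \<gamma> \<phi> n m)
        \<le> (\<Sum>n\<in>{1..<m}. 4 * \<phi> m + 2 * real m * \<phi> m *
            (if real m \<le> K * real (m div gcd n m) ^ h then (real (gcd n m) / real m)\<^sup>2 else 0))"
      by (intro sum_mono term_le)
    also have "\<dots> = real (m - 1) * (4 * \<phi> m) + 2 * real m * \<phi> m *
        (\<Sum>n | n \<in> {1..<m} \<and> real m \<le> K * real (m div gcd n m) ^ h. (real (gcd n m) / real m)\<^sup>2)"
      unfolding filter by (simp add: sum.distrib flip: sum_distrib_left)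
    also have "\<dots> \<le> real m * (4 * \<phi> m) + 2 * real m * \<phi> m * B"
      using m \<phi>(1)[of m] by (intro add_mono mult_right_mono mult_left_mono B(2)) auto
    finally show "(\<Sum>n\<in>{1..<m}. real (gcd n m) * parallel_overlap \<gamma> \<phi> n m) \<le> (4 + 2 * B) * (real m * \<phi> m)"
      by (simp add: algebra_simps)
  qed
qed

section \<open>Almost sure behaviour\<close>

lemma filterlim_sum_at_top_if_not_summable:
  fixes f :: "nat \<Rightarrow> real"
  assumes "\<And>n. 0 \<le> f n" "\<not> summable f"
  shows "filterlim (\<lambda>N. \<Sum>n<N. f n) at_top sequentially"
  unfolding filterlim_at_top
proof
  fix Z :: real
  obtain N where N: "Z \<le> (\<Sum>n<N. f n)"
    using summableI_nonneg_bounded[where f = f and x = Z] assms by (meson le_cases)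
  have "Z \<le> (\<Sum>n<M. f n)" if "N \<le> M" for M
    using N sum_mono2[of "{..<M}" "{..<N}" f] that assms(1) by fastforce
  then show "eventually (\<lambda>N. Z \<le> (\<Sum>n<N. f n)) sequentially"
    by (auto simp: eventually_sequentially)
qed

lemma measure_form_near:
  assumes "(q1, q2) \<noteq> (0, 0)" "0 \<le> s" "s \<le> 1/2"
  shows "measure unit_square (form_near c s q1 q2) = 2 * s"
  using assms by (intro measure_eq_emeasure_eq_ennreal) (simp_all add: emeasure_form_near emeasure_near_int)

lemma measure_form_near_Int:
  assumes "n \<noteq> 0" "k' * n \<noteq> m * k" "0 \<le> s" "s \<le> 1/2" "0 \<le> t" "t \<le> 1/2"
  shows "measure unit_square (form_near c s k n \<inter> form_near c t k' m) = (2 * s) * (2 * t)"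
  using assms by (intro measure_eq_emeasure_eq_ennreal)
    (simp_all add: emeasure_form_near_Int emeasure_near_int ennreal_mult[symmetric])

text \<open>Each \<open>n\<close> carries \<open>n\<close> events of measure
  \<open>2 * \<phi> n\<close>, so the expected counts diverge with the series. Non-parallel vectors
  give independent events, and the excess of the parallel pairs is linear in the expected
  count.\<close>

lemma AE_infinite_form_near:
  fixes \<gamma> :: real and \<phi> :: "nat \<Rightarrow> real"
  assumes \<gamma>: "\<gamma> \<notin> \<rat>" "\<not> liouville_number \<gamma>"
    and \<phi>: "\<And>n. 1 \<le> n \<Longrightarrow> 0 \<le> \<phi> n" "\<And>n. 1 \<le> n \<Longrightarrow> \<phi> n \<le> 1 / (2 * real n)"
    and diverges: "\<not> summable (\<lambda>n. real n * \<phi> n)"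
  shows "AE z in unit_square. infinite {(n, k). k \<in> {1..n} \<and> z \<in> form_near \<gamma> (\<phi> n) (int k) (int n)}"
proof -
  \<comment> \<open>Index pairs outside the range get the empty event and never occur.\<close>
  define A where "A = (\<lambda>(n, k). if k \<in> {1..n} then form_near \<gamma> (\<phi> n) (int k) (int n) else {})"
  define F where "F N = Sigma {1..N} (\<lambda>n. {1..n})" for N :: nat
  define S where "S N = (\<Sum>i\<in>F N. measure unit_square (A i))" for N
  \<comment> \<open>A parallel pair is recorded in one order only, smaller norm first; hence both
    \<open>e i j\<close> and \<open>e j i\<close> enter the estimate below.\<close>
  define e where "e = (\<lambda>(n, k) (m, l). if n < m \<and> l * n = m * k then parallel_overlap \<gamma> \<phi> n m else 0)"
  have sumF: "(\<Sum>i\<in>F N. f i) = (\<Sum>n=1..N. \<Sum>k=1..n. f (n, k))" for N and f :: "nat \<times> nat \<Rightarrow> real"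
    unfolding F_def by (subst sum.Sigma) auto
  have finF: "finite (F N)" for N by (simp add: F_def)
  have half: "\<phi> n \<le> 1/2" if "1 \<le> n" for n
  proof -
    have "1 / (2 * real n) \<le> 1/2" using that by (simp add: field_simps)
    then show ?thesis using \<phi>(2)[OF that] by linarith
  qed
  have A: "A (n, k) = form_near \<gamma> (\<phi> n) (int k) (int n)" if "k \<in> {1..n}" for n k
    using that by (simp add: A_def)
  have A_meas: "A i \<in> sets unit_square" for i
    using form_near_measurable[of \<gamma>] by (cases i) (simp add: A_def)
  have probA: "measure unit_square (A (n, k)) = 2 * \<phi> n" if "k \<in> {1..n}" for n k
    using that \<phi>(1)[of n] half[of n] unfolding A[OF that] by (intro measure_form_near) auto
  have S: "S N = 2 * (\<Sum>n<Suc N. real n * \<phi> n)" for N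
  proof -
    have "S N = (\<Sum>n=1..N. \<Sum>k=1..n. 2 * \<phi> n)" unfolding S_def sumF by (intro sum.cong refl probA)
    also have "\<dots> = 2 * (\<Sum>n=1..N. real n * \<phi> n)" by (simp add: sum_distrib_left mult.left_commute)
    also have "(\<Sum>n=1..N. real n * \<phi> n) = (\<Sum>n<Suc N. real n * \<phi> n)"
      by (intro sum.mono_neutral_left) auto
    finally show ?thesis .
  qed
  have "0 \<le> real n * \<phi> n" for n using \<phi>(1)[of n] by (cases "n = 0") auto
  then have "filterlim (\<lambda>N. \<Sum>n<Suc N. real n * \<phi> n) at_top sequentially"
    by (intro filterlim_compose[OF filterlim_sum_at_top_if_not_summable filterlim_Suc] diverges)
  then have S_top: "filterlim S at_top sequentially"
    unfolding S by (intro filterlim_tendsto_pos_mult_at_top[OF tendsto_const]) auto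
  have e_nonneg: "0 \<le> e i j" if "i \<in> F N" for i j N
    using that by (cases i; cases j) (auto simp: e_def F_def intro!: parallel_overlap_nonneg \<phi>(1))
  have pair: "measure unit_square (A i \<inter> A j)
      \<le> measure unit_square (A i) * measure unit_square (A j) + (if i = j then measure unit_square (A i) else 0) + e i j + e j i"
    if ij: "i \<in> F N" "j \<in> F N" for i j N
  proof -
    obtain n k m l where nk: "i = (n, k)" "j = (m, l)" by (metis surj_pair)
    have range: "k \<in> {1..n}" "l \<in> {1..m}" using ij nk by (auto simp: F_def)
    then have pos: "1 \<le> n" "1 \<le> m" by auto
    have prod_nonneg: "0 \<le> measure unit_square (A i) * measure unit_square (A j)" by simp
    have diag_nonneg: "0 \<le> (if i = j then measure unit_square (A i) else 0)" by simp
    note e0 = e_nonneg[OF ij(1), of j] e_nonneg[OF ij(2), of i]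
    have overlap: "measure unit_square (form_near \<gamma> (\<phi> n) (int k) (int n) \<inter> form_near \<gamma> (\<phi> m) (int l) (int m))
        \<le> parallel_overlap \<gamma> \<phi> n m" if "1 \<le> n" "1 \<le> m" "l * n = m * k" for n k m l
      unfolding measure_def using that \<phi>(1)
      by (intro enn2real_leI emeasure_form_near_Int_le_parallel_overlap parallel_overlap_nonneg) auto
    \<comment> \<open>Parallel vectors with \<open>n = m\<close> coincide because \<open>n\<close>
      is positive; they make up the diagonal term.\<close>
    consider (indep) "l * n \<noteq> m * k" | (less) "l * n = m * k" "n < m" | (gr) "l * n = m * k" "m < n"
      | (eq) "l * n = m * k" "n = m" by linarith
    then show ?thesis
    proof cases
      case indep
      then have "int l * int n \<noteq> int m * int k" by (metis of_nat_eq_iff of_nat_mult)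
      then have "measure unit_square (A i \<inter> A j) = (2 * \<phi> n) * (2 * \<phi> m)"
        unfolding nk A[OF range(1)] A[OF range(2)]
        using pos \<phi>(1) half by (intro measure_form_near_Int) auto
      also have "\<dots> = measure unit_square (A i) * measure unit_square (A j)"
        unfolding nk probA[OF range(1)] probA[OF range(2)] ..
      finally show ?thesis using e0 by simp
    next
      case less
      then have "measure unit_square (A i \<inter> A j) \<le> e i j"
        using overlap[OF pos less(1)] unfolding nk A[OF range(1)] A[OF range(2)] by (simp add: e_def)
      then show ?thesis using e0 prod_nonneg diag_nonneg by linarith
    next
      case gr
      then have "measure unit_square (A i \<inter> A j) \<le> e j i"
        using overlap[OF pos(2,1), of k l] unfolding nk A[OF range(1)] A[OF range(2)]
        by (simp add: e_def Int_commute mult.commute)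
      then show ?thesis using e0 prod_nonneg diag_nonneg by linarith
    next
      case eq
      then have "i = j" using nk pos by simp
      then show ?thesis using e0 prod_nonneg by simp
    qed
  qed
  obtain B where B: "0 \<le> B" "\<And>m. 1 \<le> m \<Longrightarrow>
      (\<Sum>n\<in>{1..<m}. real (gcd n m) * parallel_overlap \<gamma> \<phi> n m) \<le> B * (real m * \<phi> m)"
    using sum_parallel_overlap_le[OF \<gamma> \<phi>] by blast
  have E: "(\<Sum>i\<in>F N. \<Sum>j\<in>F N. e i j) \<le> B * S N" for N
  proof -
    have "(\<Sum>i\<in>F N. \<Sum>j\<in>F N. e i j) = (\<Sum>n=1..N. \<Sum>m=1..N. \<Sum>k=1..n. \<Sum>l=1..m. e (n, k) (m, l))"
      unfolding sumF by (intro sum.cong refl sum.swap)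
    also have "\<dots> = (\<Sum>m=1..N. \<Sum>n=1..N. \<Sum>k=1..n. \<Sum>l=1..m. e (n, k) (m, l))"
      by (rule sum.swap)
    also have "\<dots> \<le> (\<Sum>m=1..N. B * (real m * \<phi> m))"
    proof (rule sum_mono)
      fix m assume m: "m \<in> {1..N}"
      \<comment> \<open>For fixed \<open>n < m\<close> at most \<open>gcd n m\<close> pairs
        \<open>(k, l)\<close> are parallel, which yields the weight in
        \<open>sum_parallel_overlap_le\<close>.\<close>
      have inner: "(\<Sum>k=1..n. \<Sum>l=1..m. e (n, k) (m, l))
          \<le> (if n < m then real (gcd n m) * parallel_overlap \<gamma> \<phi> n m else 0)" if n: "n \<in> {1..N}" for n
      proof (cases "n < m")
        case True
        have "(\<Sum>k=1..n. \<Sum>l=1..m. e (n, k) (m, l))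
            = (\<Sum>(k, l)\<in>{1..n} \<times> {1..m}. if l * n = m * k then parallel_overlap \<gamma> \<phi> n m else 0)"
          using True by (simp add: e_def sum.cartesian_product)
        also have "\<dots> = (\<Sum>p\<in>{p \<in> {1..n} \<times> {1..m}. snd p * n = m * fst p}. parallel_overlap \<gamma> \<phi> n m)"
          by (subst sum.inter_filter) (auto simp: case_prod_beta)
        also have "\<dots> = real (card {(k, l). k \<in> {1..n} \<and> l \<in> {1..m} \<and> l * n = m * k}) * parallel_overlap \<gamma> \<phi> n m"
        proof -
          have "{p \<in> {1..n} \<times> {1..m}. snd p * n = m * fst p} = {(k, l). k \<in> {1..n} \<and> l \<in> {1..m} \<and> l * n = m * k}"
            by auto
          then show ?thesis by simp
        qed
        also have "\<dots> \<le> real (gcd n m) * parallel_overlap \<gamma> \<phi> n m"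
          using n m \<phi>(1) by (intro mult_right_mono of_nat_mono card_parallel_le parallel_overlap_nonneg) auto
        finally show ?thesis using True by simp
      qed (simp add: e_def)
      have "(\<Sum>n=1..N. \<Sum>k=1..n. \<Sum>l=1..m. e (n, k) (m, l))
          \<le> (\<Sum>n=1..N. if n < m then real (gcd n m) * parallel_overlap \<gamma> \<phi> n m else 0)"
        by (rule sum_mono[OF inner])
      also have "\<dots> = (\<Sum>n\<in>{n \<in> {1..N}. n < m}. real (gcd n m) * parallel_overlap \<gamma> \<phi> n m)"
        by (rule sum.inter_filter[symmetric]) simp
      also have "{n \<in> {1..N}. n < m} = {1..<m}" using m by auto
      finally show "(\<Sum>n=1..N. \<Sum>k=1..n. \<Sum>l=1..m. e (n, k) (m, l)) \<le> B * (real m * \<phi> m)"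
        using B(2)[of m] m by simp
    qed
    also have "\<dots> = B * (\<Sum>m=1..N. real m * \<phi> m)" by (simp add: sum_distrib_left)
    also have "\<dots> \<le> B * S N"
    proof (rule mult_left_mono[OF _ B(1)])
      have "0 \<le> (\<Sum>m=1..N. real m * \<phi> m)" by (intro sum_nonneg mult_nonneg_nonneg \<phi>(1)) auto
      moreover have "S N = 2 * (\<Sum>m=1..N. real m * \<phi> m)"
        unfolding S_def sumF by (simp add: probA sum_distrib_left mult.left_commute)
      ultimately show "(\<Sum>m=1..N. real m * \<phi> m) \<le> S N" by simp
    qed
    finally show ?thesis .
  qed
  \<comment> \<open>The 1 is the diagonal, the \<open>2 * B\<close> the two orders of the parallel
    pairs.\<close>
  have "(\<Sum>i\<in>F N. \<Sum>j\<in>F N. measure unit_square (A i \<inter> A j)) \<le> (S N)\<^sup>2 + (1 + 2 * B) * S N" for N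
  proof -
    have "(\<Sum>i\<in>F N. \<Sum>j\<in>F N. measure unit_square (A i \<inter> A j))
        \<le> (\<Sum>i\<in>F N. \<Sum>j\<in>F N. measure unit_square (A i) * measure unit_square (A j)
            + (if i = j then measure unit_square (A i) else 0) + e i j + e j i)"
      by (intro sum_mono pair)
    also have "\<dots> = (S N)\<^sup>2 + S N + (\<Sum>i\<in>F N. \<Sum>j\<in>F N. e i j) + (\<Sum>i\<in>F N. \<Sum>j\<in>F N. e j i)"
      by (simp add: sum.distrib S_def power2_eq_square sum_product finF)
    also have "(\<Sum>i\<in>F N. \<Sum>j\<in>F N. e j i) = (\<Sum>i\<in>F N. \<Sum>j\<in>F N. e i j)" by (rule sum.swap)
    finally show ?thesis using E[of N] by (simp add: algebra_simps)
  qed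
  then have "AE z in unit_square. infinite {i. z \<in> A i}"
    using S_top unfolding S_def
    by (intro unit_unif2.AE_infinite_if_variance_le[where F = F] A_meas finF)
  moreover have "{i. z \<in> A i} = {(n, k). k \<in> {1..n} \<and> z \<in> form_near \<gamma> (\<phi> n) (int k) (int n)}" for z
    by (auto simp: A_def split: if_splits)
  ultimately show ?thesis by simp
qed

section \<open>Transfer to Lebesgue measure on the plane\<close>

text \<open>\<open>unit_square\<close> has the indicator of \<open>torus2\<close> as density with
  respect to plane Lebesgue measure.\<close>

lemma AE_unit_square_imp_AE_lebesgue:
  assumes "AE z in unit_square. P z"
  shows "AE z in lebesgue. z \<in> torus2 \<longrightarrow> P z"
proof -
  have "sigma_finite_measure (density lborel (indicator {0..<1::real}))"
    using unit_unif.sigma_finite_measure_axioms by (simp add: unit_unif_def)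
  then have eq: "unit_square = density (lborel \<Otimes>\<^sub>M lborel) (\<lambda>(x, y). indicator {0..<1} x * indicator {0..<1} y)"
    unfolding unit_unif_def by (intro pair_measure_density lborel.sigma_finite_measure_axioms) auto
  have "AE z in density (lborel \<Otimes>\<^sub>M lborel) (\<lambda>(x, y). indicator {0..<1} x * indicator {0..<1} y). P z"
    using assms unfolding eq .
  then have "AE z in (lborel \<Otimes>\<^sub>M lborel).
      (0 :: ennreal) < (case z of (x, y) \<Rightarrow> indicator {0..<1} x * indicator {0..<1} y) \<longrightarrow> P z"
    by (subst (asm) AE_density) measurable
  then have "AE z in (lborel \<Otimes>\<^sub>M lborel). z \<in> torus2 \<longrightarrow> P z"
    by eventually_elim (auto simp: torus2_def indicator_def)
  then show ?thesis unfolding lborel_prod by (rule AE_completion)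
qed

text \<open>Completeness makes subsets of null sets measurable; the measurability of the
  approximation set rests on this.\<close>

lemma AE_lebesgue_not_imp_null:
  assumes "AE z in lebesgue. z \<notin> X"
  shows "X \<in> null_sets lebesgue"
proof -
  obtain N where "N \<in> null_sets lebesgue" "{z \<in> space lebesgue. \<not> z \<notin> X} \<subseteq> N"
    using assms by (auto simp: eventually_ae_filter)
  then show ?thesis using null_sets_completion_subset[of X N lborel] by auto
qed

lemma emeasure_torus2: "torus2 \<in> sets lebesgue" "emeasure lebesgue torus2 = 1"
proof -
  have "torus2 \<in> sets (lborel \<Otimes>\<^sub>M lborel)" unfolding torus2_def by (rule pair_measureI) auto
  then have b: "torus2 \<in> sets lborel" by (simp only: lborel_prod)
  then show "torus2 \<in> sets lebesgue" by (rule sets_completionI_sets)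
  have "emeasure (lborel \<Otimes>\<^sub>M lborel) torus2 = 1"
    unfolding torus2_def by (subst lborel.emeasure_pair_measure_Times) auto
  then show "emeasure lebesgue torus2 = 1"
    using b by (simp add: lborel_prod)
qed

lemma form_near_iff:
  "z \<in> form_near \<gamma> s q1 q2 \<longleftrightarrow> (\<exists>p::int. \<bar>of_int q1 * fst z + of_int q2 * snd z + of_int p - \<gamma>\<bar> \<le> s)"
proof
  assume "z \<in> form_near \<gamma> s q1 q2"
  then obtain p :: int where "\<bar>of_int q1 * fst z + of_int q2 * snd z - of_int p - \<gamma>\<bar> \<le> s"
    by (auto simp: form_near_def near_int_def)
  then show "\<exists>p::int. \<bar>of_int q1 * fst z + of_int q2 * snd z + of_int p - \<gamma>\<bar> \<le> s"
    by (intro exI[of _ "- p"]) simp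
next
  assume "\<exists>p::int. \<bar>of_int q1 * fst z + of_int q2 * snd z + of_int p - \<gamma>\<bar> \<le> s"
  then obtain p :: int where "\<bar>of_int q1 * fst z + of_int q2 * snd z + of_int p - \<gamma>\<bar> \<le> s" ..
  then show "z \<in> form_near \<gamma> s q1 q2"
    by (auto simp: form_near_def near_int_def intro!: exI[of _ "- p"])
qed

text \<open>The terms of a convergent series fall below \<open>c\<close>, after which the truncation
  changes nothing.\<close>

lemma not_summable_min:
  fixes f :: "nat \<Rightarrow> real"
  assumes "\<not> summable f" "0 < c"
  shows "\<not> summable (\<lambda>n. min (f n) c)"
proof
  assume s: "summable (\<lambda>n. min (f n) c)"
  then have "eventually (\<lambda>n. min (f n) c < c) sequentially"
    using order_tendstoD(2)[OF summable_LIMSEQ_zero] assms(2) by blast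
  then have "eventually (\<lambda>n. min (f n) c = f n) sequentially" by eventually_elim auto
  from summable_cong[OF this] show False using s assms(1) by blast
qed

section \<open>Convergence: finitely many solutions almost surely\<close>

lemma card_sup_norm_sphere_le:
  "finite {(q1 :: int, q2 :: int). max \<bar>q1\<bar> \<bar>q2\<bar> = int n}"
  "card {(q1 :: int, q2 :: int). max \<bar>q1\<bar> \<bar>q2\<bar> = int n} \<le> 8 * n + 4"
proof -
  define I where "I = {- int n..int n}"
  have I: "finite I" "card I = 2 * n + 1" by (auto simp: I_def)
  define E where "E = {int n, - int n}"
  have E: "finite E" "card E \<le> 2" by (auto simp: E_def card_insert_if)
  \<comment> \<open>The two pairs of opposite sides of a square.\<close>
  have sub: "{(q1 :: int, q2 :: int). max \<bar>q1\<bar> \<bar>q2\<bar> = int n} \<subseteq> E \<times> I \<union> I \<times> E"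
    by (auto simp: E_def I_def max_def abs_if split: if_splits)
  then show "finite {(q1 :: int, q2 :: int). max \<bar>q1\<bar> \<bar>q2\<bar> = int n}"
    by (rule finite_subset) (use I E in auto)
  have "card {(q1 :: int, q2 :: int). max \<bar>q1\<bar> \<bar>q2\<bar> = int n} \<le> card (E \<times> I \<union> I \<times> E)"
    using sub by (rule card_mono[rotated]) (use I E in auto)
  also have "\<dots> \<le> card (E \<times> I) + card (I \<times> E)" by (rule card_Un_le)
  also have "\<dots> = 2 * (card E * (2 * n + 1))" using I by (simp add: card_cartesian_product)
  also have "\<dots> \<le> 2 * (2 * (2 * n + 1))" using E by (intro mult_le_mono) auto
  finally show "card {(q1 :: int, q2 :: int). max \<bar>q1\<bar> \<bar>q2\<bar> = int n} \<le> 8 * n + 4" by simp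
qed

text \<open>Borel-Cantelli: there are O(n) vectors of norm \<open>n\<close>, with events of measure
  at most \<open>2 * \<psi> n\<close>. Almost surely only finitely many vectors then admit
  solutions, each with finitely many \<open>p\<close>.\<close>

lemma AE_finitely_many_solutions:
  fixes \<psi> :: "nat \<Rightarrow> real"
  assumes \<psi>: "\<And>q. q \<ge> 1 \<Longrightarrow> 0 \<le> \<psi> q" and sum: "summable (\<lambda>q. real q * \<psi> q)"
  shows "AE z in unit_square. finite {((q1 :: int, q2 :: int), p :: int). (q1, q2) \<noteq> (0, 0) \<and>
    \<bar>of_int q1 * fst z + of_int q2 * snd z + of_int p - \<gamma>\<bar> \<le> \<psi> (nat (max \<bar>q1\<bar> \<bar>q2\<bar>))}"
proof -
  define Q where "Q n = {(q1 :: int, q2 :: int). max \<bar>q1\<bar> \<bar>q2\<bar> = int n}" for n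
  have finQ: "finite (Q n)" for n unfolding Q_def by (rule card_sup_norm_sphere_le)
  \<comment> \<open>Norm 0 belongs to the excluded zero vector alone.\<close>
  define B where "B n = (if n = 0 then {} else (\<Union>(q1, q2)\<in>Q n. form_near \<gamma> (\<psi> n) q1 q2))" for n
  have B_sets: "B n \<in> sets unit_square" for n
    unfolding B_def using finQ form_near_measurable by (auto intro!: sets.finite_UN simp del: sets_unit_unif)
  have B_le: "measure unit_square (B n) \<le> 24 * (real n * \<psi> n)" for n
  proof (cases "n = 0")
    case False
    then have n: "1 \<le> n" by simp
    have "measure unit_square (B n) = measure unit_square (\<Union>q\<in>Q n. form_near \<gamma> (\<psi> n) (fst q) (snd q))"
      using False by (simp add: B_def case_prod_beta)
    also have "\<dots> \<le> (\<Sum>q\<in>Q n. measure unit_square (form_near \<gamma> (\<psi> n) (fst q) (snd q)))"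
      using finQ form_near_measurable
      by (intro unit_unif2.finite_measure_subadditive_finite) auto
    also have "\<dots> \<le> (\<Sum>q\<in>Q n. 2 * \<psi> n)"
    proof (rule sum_mono)
      fix q assume "q \<in> Q n"
      then have q: "(fst q, snd q) \<noteq> (0, 0)" using n by (auto simp: Q_def)
      show "measure unit_square (form_near \<gamma> (\<psi> n) (fst q) (snd q)) \<le> 2 * \<psi> n"
        unfolding measure_def emeasure_form_near[OF q]
        using \<psi>[OF n] by (intro enn2real_leI emeasure_near_int_le) auto
    qed
    also have "\<dots> = real (card (Q n)) * (2 * \<psi> n)" by simp
    \<comment> \<open>\<open>8 * n + 4 \<le> 12 * n\<close> for \<open>n \<ge> 1\<close>.\<close>
    also have "\<dots> \<le> (12 * real n) * (2 * \<psi> n)"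
      using card_sup_norm_sphere_le(2)[of n] n \<psi>[OF n] unfolding Q_def[symmetric]
      by (intro mult_right_mono) auto
    finally show ?thesis by simp
  qed (simp add: B_def)
  have "AE z in unit_square. eventually (\<lambda>n. z \<in> space unit_square - B n) sequentially"
  proof (rule borel_cantelli_AE1[OF B_sets])
    show "emeasure unit_square (B n) < \<infinity>" for n by (simp add: unit_unif2.emeasure_eq_measure)
    show "summable (\<lambda>n. measure unit_square (B n))"
      by (rule summable_comparison_test[OF _ summable_mult[OF sum, of 24]]) (auto intro!: B_le)
  qed
  then show ?thesis
  proof eventually_elim
    case (elim z)
    then obtain N where N: "\<And>n. N \<le> n \<Longrightarrow> z \<notin> B n" by (auto simp: eventually_sequentially)
    define v where "v q = of_int (fst q) * fst z + of_int (snd q) * snd z" for q :: "int \<times> int"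
    \<comment> \<open>The absolute value keeps the radius nonnegative at \<open>n = 0\<close> too,
      where the sign of \<open>\<psi>\<close> is unknown.\<close>
    have "{((q1 :: int, q2 :: int), p :: int). (q1, q2) \<noteq> (0, 0) \<and>
        \<bar>of_int q1 * fst z + of_int q2 * snd z + of_int p - \<gamma>\<bar> \<le> \<psi> (nat (max \<bar>q1\<bar> \<bar>q2\<bar>))}
      \<subseteq> (\<Union>n\<in>{..<N}. \<Union>q\<in>Q n. Pair q ` {p. \<bar>(v q - \<gamma>) + of_int p\<bar> \<le> \<bar>\<psi> n\<bar>})"
    proof
      fix x assume x: "x \<in> {((q1 :: int, q2 :: int), p :: int). (q1, q2) \<noteq> (0, 0) \<and>
        \<bar>of_int q1 * fst z + of_int q2 * snd z + of_int p - \<gamma>\<bar> \<le> \<psi> (nat (max \<bar>q1\<bar> \<bar>q2\<bar>))}"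
      obtain q1 q2 p where x_eq: "x = ((q1, q2), p)" by (metis surj_pair)
      have q0: "(q1, q2) \<noteq> (0, 0)"
        and ineq: "\<bar>of_int q1 * fst z + of_int q2 * snd z + of_int p - \<gamma>\<bar> \<le> \<psi> (nat (max \<bar>q1\<bar> \<bar>q2\<bar>))"
        using x unfolding x_eq by simp_all
      define n where "n = nat (max \<bar>q1\<bar> \<bar>q2\<bar>)"
      have q: "(q1, q2) \<in> Q n" by (simp add: Q_def n_def)
      have "n \<noteq> 0" using q0 by (auto simp: n_def max_def split: if_splits)
      moreover have "z \<in> form_near \<gamma> (\<psi> n) q1 q2" using ineq by (auto simp: form_near_iff n_def)
      ultimately have "z \<in> B n" using q by (auto simp: B_def)
      then have "n < N" using N[of n] by (meson not_less)
      moreover have "p \<in> {p. \<bar>(v (q1, q2) - \<gamma>) + of_int p\<bar> \<le> \<bar>\<psi> n\<bar>}"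
        using ineq by (simp add: v_def n_def[symmetric] algebra_simps)
      ultimately show "x \<in> (\<Union>n\<in>{..<N}. \<Union>q\<in>Q n. Pair q ` {p. \<bar>(v q - \<gamma>) + of_int p\<bar> \<le> \<bar>\<psi> n\<bar>})"
        using q unfolding x_eq by blast
    qed
    then show ?case
      by (rule finite_subset) (intro finite_UN_I finite_imageI finQ card_int_near_le(1), auto)
  qed
qed

theorem theorem1:
  fixes \<psi> :: "nat \<Rightarrow> real" and \<gamma> :: real
  assumes "\<And>q. q \<ge> 1 \<Longrightarrow> 0 \<le> \<psi> q"
    and "\<gamma> \<notin> \<rat>"
    and "\<not> liouville_number \<gamma>"
  shows "inhom_approx_set \<psi> \<gamma> \<in> sets lebesgue \<and>
         emeasure lebesgue (inhom_approx_set \<psi> \<gamma>) =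
           (if summable (\<lambda>q. real q * \<psi> q) then 0 else 1)"
proof -
  define sol where "sol z = {((q1 :: int, q2 :: int), p :: int). (q1, q2) \<noteq> (0, 0) \<and>
    \<bar>of_int q1 * fst z + of_int q2 * snd z + of_int p - \<gamma>\<bar> \<le> \<psi> (nat (max \<bar>q1\<bar> \<bar>q2\<bar>))}" for z :: "real \<times> real"
  have X: "inhom_approx_set \<psi> \<gamma> = {z \<in> torus2. infinite (sol z)}"
    by (auto simp: inhom_approx_set_def sol_def)
  show ?thesis
  proof (cases "summable (\<lambda>q. real q * \<psi> q)")
    case True
    have "AE z in unit_square. finite (sol z)"
      unfolding sol_def by (rule AE_finitely_many_solutions[OF assms(1) True])
    from AE_unit_square_imp_AE_lebesgue[OF this]
    have "AE z in lebesgue. z \<notin> inhom_approx_set \<psi> \<gamma>"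
      by eventually_elim (auto simp: X)
    from AE_lebesgue_not_imp_null[OF this] show ?thesis using True by auto
  next
    case False
    \<comment> \<open>This caps \<open>q * \<psi> q\<close> at 1/2, which preserves divergence and
      meets the bound that the overlap estimate requires.\<close>
    define \<phi> where "\<phi> n = min (\<psi> n) (1 / (2 * real n))" for n
    have "real q * \<phi> q = min (real q * \<psi> q) (1/2)" if "q \<noteq> 0" for q
      using that by (auto simp: \<phi>_def min_def field_simps)
    then have "eventually (\<lambda>q. real q * \<phi> q = min (real q * \<psi> q) (1/2)) sequentially"
      by (intro eventually_sequentiallyI[of 1]) auto
    then have "summable (\<lambda>q. real q * \<phi> q) \<longleftrightarrow> summable (\<lambda>q. min (real q * \<psi> q) (1/2))"
      by (rule summable_cong)
    then have diverges: "\<not> summable (\<lambda>q. real q * \<phi> q)"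
      using not_summable_min[OF False, of "1/2"] by simp
    have "AE z in unit_square. infinite {(n, k). k \<in> {1..n} \<and> z \<in> form_near \<gamma> (\<phi> n) (int k) (int n)}"
      using assms by (intro AE_infinite_form_near diverges) (auto simp: \<phi>_def)
    then have "AE z in unit_square. infinite (sol z)"
    proof eventually_elim
      case (elim z)
      define W where "W = {(n, k). k \<in> {1..n} \<and> z \<in> form_near \<gamma> (\<phi> n) (int k) (int n)}"
      \<comment> \<open>An index \<open>(n, k)\<close> stands for the vector \<open>(k, n)\<close>.
        Forgetting \<open>p\<close> and swapping maps \<open>sol z\<close> onto a superset of the
        infinite set \<open>W\<close>, so \<open>sol z\<close> is infinite.\<close>
      have "W \<subseteq> (\<lambda>((q1, q2), p). (nat q2, nat q1)) ` sol z"
      proof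
        fix i assume "i \<in> W"
        then obtain n k where i: "i = (n, k)" and nk: "k \<in> {1..n}" "z \<in> form_near \<gamma> (\<phi> n) (int k) (int n)"
          by (auto simp: W_def)
        then obtain p :: int where "\<bar>of_int (int k) * fst z + of_int (int n) * snd z + of_int p - \<gamma>\<bar> \<le> \<phi> n"
          by (auto simp: form_near_iff)
        also have "\<dots> \<le> \<psi> n" by (simp add: \<phi>_def)
        finally have "((int k, int n), p) \<in> sol z" using nk(1) by (simp add: sol_def max_absorb2)
        then show "i \<in> (\<lambda>((q1, q2), p). (nat q2, nat q1)) ` sol z"
          unfolding i by (rule rev_image_eqI) simp
      qed
      then show ?case using elim finite_surj unfolding W_def by blast
    qed
    from AE_unit_square_imp_AE_lebesgue[OF this]
    have "AE z in lebesgue. z \<notin> torus2 - inhom_approx_set \<psi> \<gamma>"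
      by eventually_elim (auto simp: X)
    then have null: "torus2 - inhom_approx_set \<psi> \<gamma> \<in> null_sets lebesgue"
      by (rule AE_lebesgue_not_imp_null)
    \<comment> \<open>Written as the torus minus a null set, the approximation set is measurable of
      full measure.\<close>
    have eq: "inhom_approx_set \<psi> \<gamma> = torus2 - (torus2 - inhom_approx_set \<psi> \<gamma>)"
      by (auto simp: X)
    have "inhom_approx_set \<psi> \<gamma> \<in> sets lebesgue"
      by (subst eq, rule sets.Diff) (use null emeasure_torus2 in auto)
    moreover have "emeasure lebesgue (inhom_approx_set \<psi> \<gamma>) = 1"
      by (subst eq) (simp only: emeasure_Diff_null_set[OF null] emeasure_torus2)
    ultimately show ?thesis using False by simp
  qed
qed

end
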